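(* There exist $5$-GDDs of types $2^{35}$, $2^{71}$, $2^{111}$, $3^{45}$, $6^{15}$, $10^{15}$, $10^{23}$ and $10^{33}$.
   Context: A $5$-GDD (group divisible design with block size $5$) of type $g_1^{u_1} g_2^{u_2} \cdots g_r^{u_r}$ is an ordered triple $(V,\mathcal{G},\mathcal{B})$ such that: (i) $V$ is a base set of cardinality $u_1 g_1 + u_2 g_2 + \cdots + u_r g_r$; (ii) $\mathcal{G}$ is a partition of $V$ into $u_i$ subsets of cardinality $g_i$, $i = 1, 2, \dots, r$, called groups; (iii) $\mathcal{B}$ is a non-empty collection of subsets of $V$, each of cardinality $5$, called blocks; (iv) each pair of elements from distinct groups occurs in precisely one block, but no pair of (distinct) elements from the same group occurs in any block. In particular, a $5$-GDD of type $g^u$ has exactly $u$ groups, each of size $g$. *)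

theory Defs
  imports Main "HOL-Library.Disjoint_Sets" "HOL-Library.Multiset"
begin

text \<open>
  A group type $g_1^{u_1} \cdots g_r^{u_r}$ is the list of pairs $(g_i, u_i)$.
\<close>
type_synonym group_type = "(nat \<times> nat) list"

text \<open>
  The condition on the group sizes is an equality of multisets, so that it remains correct
  when a size $g_i$ is repeated in the list. Finiteness of \<open>V\<close> is explicit because \<open>card\<close> and
  \<open>mset_set\<close> take junk values on infinite sets. The blocks form a set: two equal blocks of
  size at least 2 would cover some pair of points twice, which the last two clauses exclude.
\<close>
definition gdd :: "nat \<Rightarrow> group_type \<Rightarrow> 'a set \<times> 'a set set \<times> 'a set set \<Rightarrow> bool" where
  "gdd k T = (\<lambda>(V, \<G>, \<B>).
     finite V \<and> card V = (\<Sum>(g, u)\<leftarrow>T. u * g) \<and>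
     partition_on V \<G> \<and>
     image_mset card (mset_set \<G>) = (\<Sum>(g, u)\<leftarrow>T. replicate_mset u g) \<and>
     \<B> \<noteq> {} \<and> (\<forall>B\<in>\<B>. B \<subseteq> V \<and> card B = k) \<and>
     (\<forall>G\<in>\<G>. \<forall>H\<in>\<G>. G \<noteq> H \<longrightarrow> (\<forall>x\<in>G. \<forall>y\<in>H. \<exists>!B. B \<in> \<B> \<and> {x, y} \<subseteq> B)) \<and>
     (\<forall>G\<in>\<G>. \<forall>x\<in>G. \<forall>y\<in>G. x \<noteq> y \<longrightarrow> \<not> (\<exists>B\<in>\<B>. {x, y} \<subseteq> B)))"

end

theory Submission
  imports Defs "HOL-Library.Countable"
begin

text \<open>
Each of the eight designs is exhibited explicitly. They were found by computer: a group of
automorphisms is prescribed, and a union of block orbits covering every orbit of cross pairs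
(pairs of points from distinct groups) exactly once is sought. What remains for the proof is to
check that the families of blocks found are indeed group divisible designs, and two observations
keep this check short.

The first is a count (\<open>gdd_if_covering\<close>). A family of \<open>k\<close>-sets that covers every cross pair and has
no more than the number \<open>v (v - g) / (k (k - 1))\<close> of blocks of a design is a design: there is no room
to cover a cross pair twice, or to cover a pair inside a group. So neither uniqueness nor the
absence of pairs inside groups has to be verified, only that each cross pair lies in some block.

The second is symmetry. In every design a cyclic group of automorphisms is retained. The points are
written \<open>(i, x)\<close>, where \<open>i\<close> is the index of an orbit and \<open>x\<close> a residue modulo its length, and a generator
adds 1 to \<open>x\<close>. The blocks are the translates of a list of base blocks, so coverage has to be checked
only for the pairs that contain one of the points \<open>(i, 0)\<close>. The list of all points joined with
\<open>(i, 0)\<close> by blocks is its link; \<open>gdd_if_checked\<close> reduces the design to the equality of this list with the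
list of the points outside the group of \<open>(i, 0)\<close>. This is an equality between concrete lists of
integers, which is decided by rewriting.
\<close>

section \<open>Coverings that are too small to be anything but designs\<close>

text \<open>
Double counting: the flags \<open>(B, x, y)\<close> with distinct \<open>x, y\<close> in the block \<open>B\<close> are at most as many as the
ordered cross pairs, while every cross pair gives at least one flag. Hence the flags correspond
exactly to the cross pairs. The groups are given as the classes of a labelling of the points.
\<close>
lemma gdd_if_covering:
  fixes V :: "'a set" and lab :: "'a \<Rightarrow> 'b"
  assumes fin: "finite V" and cardV: "card V = u * g"
    and size: "\<And>x. x \<in> V \<Longrightarrow> card {y \<in> V. lab y = lab x} = g"
    and ne: "\<B> \<noteq> {}" and k: "k > 0"
    and blk: "\<And>B. B \<in> \<B> \<Longrightarrow> B \<subseteq> V \<and> card B = k"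
    and few: "card \<B> * (k * (k - 1)) \<le> card V * (card V - g)"
    and cover: "\<And>x y. x \<in> V \<Longrightarrow> y \<in> V \<Longrightarrow> lab x \<noteq> lab y \<Longrightarrow> \<exists>B\<in>\<B>. {x, y} \<subseteq> B"
  shows "gdd k [(g, u)] (V, (\<lambda>x. {y \<in> V. lab y = lab x}) ` V, \<B>)"
proof -
  define cl where "cl x = {y \<in> V. lab y = lab x}" for x
  define X where "X = (SIGMA x:V. V - cl x)"
  define S where "S = (SIGMA B:\<B>. SIGMA x:B. B - {x})"
  have finB: "finite B" if "B \<in> \<B>" for B
    using blk[OF that] fin finite_subset by blast
  have finBB: "finite \<B>"
    using blk fin by (metis finite_Pow_iff finite_subset PowI subsetI)
  have finS: "finite S"
    unfolding S_def using finB finBB by auto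
  have "card X = (\<Sum>x\<in>V. card (V - cl x))"
    unfolding X_def using fin by (subst card_SigmaI) auto
  also have "\<dots> = (\<Sum>x\<in>V. card V - g)"
  proof (rule sum.cong[OF refl])
    fix x assume "x \<in> V"
    have "card (V - cl x) = card V - card (cl x)"
      by (rule card_Diff_subset) (auto simp: cl_def fin)
    then show "card (V - cl x) = card V - g"
      using size[OF \<open>x \<in> V\<close>] by (simp add: cl_def)
  qed
  finally have cX: "card X = card V * (card V - g)" by simp
  have "card S = (\<Sum>B\<in>\<B>. card (SIGMA x:B. B - {x}))"
    unfolding S_def using finB finBB by (subst card_SigmaI) auto
  also have "\<dots> = (\<Sum>B\<in>\<B>. k * (k - 1))"
  proof (rule sum.cong[OF refl])
    fix B assume B: "B \<in> \<B>"
    have "card (SIGMA x:B. B - {x}) = (\<Sum>x\<in>B. card (B - {x}))"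
      using finB[OF B] by (subst card_SigmaI) auto
    also have "\<dots> = (\<Sum>x\<in>B. k - 1)"
      using finB[OF B] blk[OF B] by (intro sum.cong) (auto simp: card_Diff_singleton)
    finally show "card (SIGMA x:B. B - {x}) = k * (k - 1)" using blk[OF B] by simp
  qed
  finally have cS: "card S \<le> card X" using few cX by simp
  define F where "F x y = (SOME B. B \<in> \<B> \<and> {x, y} \<subseteq> B)" for x y
  have F: "F x y \<in> \<B> \<and> {x, y} \<subseteq> F x y" if "(x, y) \<in> X" for x y
    unfolding F_def by (rule someI_ex) (use cover[of x y] that in \<open>auto simp: X_def cl_def\<close>)
  \<comment> \<open>Each cross pair names a block through it, so \<open>X\<close> embeds into the flags \<open>S\<close>. As \<open>S\<close> is no larger
    than \<open>X\<close>, every flag is hit: its pair is a cross pair, and its block is the named one.\<close>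
  define h where "h = (\<lambda>(x, y). (F x y, x, y))"
  have inj: "inj_on h X" by (auto simp: h_def inj_on_def)
  have "h ` X \<subseteq> S"
    using F by (force simp: h_def S_def X_def cl_def)
  moreover have "card (h ` X) = card X" using inj by (rule card_image)
  ultimately have hS: "h ` X = S"
    using card_subset_eq[OF finS] cS card_mono[OF finS, of "h ` X"] by simp
  have S_dest: "(x, y) \<in> X \<and> B = F x y" if "B \<in> \<B>" "x \<in> B" "y \<in> B" "x \<noteq> y" for B x y
  proof -
    have "(B, x, y) \<in> h ` X" unfolding hS using that by (auto simp: S_def)
    then show ?thesis by (auto simp: h_def)
  qed
  have g: "g > 0"
  proof -
    obtain B where B: "B \<in> \<B>" using ne by blast
    then have "B \<noteq> {}" using blk k by fastforce
    then obtain x where "x \<in> V" using blk B by blast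
    then have "card {y \<in> V. lab y = lab x} > 0"
      using fin by (subst card_gt_0_iff) auto
    then show "g > 0" using size[OF \<open>x \<in> V\<close>] by simp
  qed
  have part: "partition_on V (cl ` V)"
  proof (rule partition_onI)
    show "\<Union> (cl ` V) = V" by (auto simp: cl_def)
    show "{} \<notin> cl ` V" by (auto simp: cl_def)
    fix G H assume "G \<in> cl ` V" "H \<in> cl ` V" "G \<noteq> H"
    then obtain x y where "G = cl x" "H = cl y" "cl x \<noteq> cl y" by blast
    then show "disjnt G H" by (auto simp: cl_def disjnt_iff)
  qed
  have sizes: "card G = g" if "G \<in> cl ` V" for G
    using that size unfolding cl_def by blast
  have fcl: "finite (cl ` V)" using fin by simp
  have "card V = (\<Sum>G\<in>cl ` V. card G)"
    by (rule product_partition[OF part]) (auto simp: cl_def fin)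
  also have "\<dots> = card (cl ` V) * g" using sizes by simp
  finally have ncl: "card (cl ` V) = u" using cardV g by simp
  have "image_mset card (mset_set (cl ` V)) = image_mset (\<lambda>_. g) (mset_set (cl ` V))"
    using sizes fcl by (intro image_mset_cong) auto
  also have "\<dots> = replicate_mset u g" using ncl by (simp add: image_mset_const_eq)
  finally have ms: "image_mset card (mset_set (cl ` V)) = replicate_mset u g" .
  have lab_in: "x \<in> V \<and> y \<in> V \<and> lab x = lab y" if "G \<in> cl ` V" "x \<in> G" "y \<in> G" for G x y
    using that by (auto simp: cl_def)
  have same: "\<not> (\<exists>B\<in>\<B>. {x, y} \<subseteq> B)" if "G \<in> cl ` V" "x \<in> G" "y \<in> G" "x \<noteq> y" for G x y
    using S_dest[of _ x y] lab_in[OF that(1-3)] that(4) by (auto simp: X_def cl_def)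
  have diff: "\<exists>!B. B \<in> \<B> \<and> {x, y} \<subseteq> B"
    if "G \<in> cl ` V" "H \<in> cl ` V" "G \<noteq> H" "x \<in> G" "y \<in> H" for G H x y
  proof -
    have xy: "x \<in> V" "y \<in> V" "lab x \<noteq> lab y" using that by (auto simp: cl_def)
    then obtain B where "B \<in> \<B> \<and> {x, y} \<subseteq> B" using cover by blast
    moreover have "C = F x y" if "C \<in> \<B> \<and> {x, y} \<subseteq> C" for C
      using S_dest[of C x y] that xy by auto
    ultimately show ?thesis by metis
  qed
  have "gdd k [(g, u)] (V, cl ` V, \<B>)"
    unfolding gdd_def split
  proof (intro conjI)
    show "\<forall>B\<in>\<B>. B \<subseteq> V \<and> card B = k" using blk by blast
    show "\<forall>G\<in>cl ` V. \<forall>H\<in>cl ` V. G \<noteq> H \<longrightarrow> (\<forall>x\<in>G. \<forall>y\<in>H. \<exists>!B. B \<in> \<B> \<and> {x, y} \<subseteq> B)"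
      by (intro ballI impI) (rule diff)
    show "\<forall>G\<in>cl ` V. \<forall>x\<in>G. \<forall>y\<in>G. x \<noteq> y \<longrightarrow> \<not> (\<exists>B\<in>\<B>. {x, y} \<subseteq> B)"
      by (intro ballI impI) (rule same)
  qed (use fin cardV part ms ne in simp_all)
  then show ?thesis by (simp add: cl_def)
qed

text \<open>
The designs below live on pairs of integers; this moves them to the natural numbers.
\<close>
lemma gdd_inj_image:
  assumes "gdd k T (V, \<G>, \<B>)" and inj: "inj_on f V"
  shows "gdd k T (f ` V, (`) f ` \<G>, (`) f ` \<B>)"
proof -
  note D = assms(1)[unfolded gdd_def split]
  note D2 = D[THEN conjunct2] and D3 = D[THEN conjunct2, THEN conjunct2, THEN conjunct2]
  note D5 = D3[THEN conjunct2, THEN conjunct2]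
  note gd = D[THEN conjunct1] D2[THEN conjunct1] D2[THEN conjunct2, THEN conjunct1]
    D3[THEN conjunct1] D3[THEN conjunct2, THEN conjunct1]
  have blk: "B \<subseteq> V" "card B = k" if "B \<in> \<B>" for B
    using bspec[OF D5[THEN conjunct1] that] by simp_all
  note cross = D5[THEN conjunct2, THEN conjunct1, THEN bspec, THEN bspec, THEN mp, THEN bspec, THEN bspec]
  note within = D5[THEN conjunct2, THEN conjunct2, THEN bspec, THEN bspec, THEN bspec, THEN mp]
  have GV: "G \<subseteq> V" if "G \<in> \<G>" for G using partition_onD1[OF gd(3)] that by blast
  have card_im: "card (f ` A) = card A" if "A \<subseteq> V" for A
    using inj that by (meson card_image inj_on_subset)
  have mem: "f x \<in> f ` A \<longleftrightarrow> x \<in> A" if "x \<in> V" "A \<subseteq> V" for x A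
    using inj_on_image_mem_iff[OF inj] that by blast
  have eq: "f ` A = f ` B \<longleftrightarrow> A = B" if "A \<subseteq> V" "B \<subseteq> V" for A B
    using inj_on_image_eq_iff[OF inj] that by blast
  have injG: "inj_on ((`) f) \<G>" using eq GV by (auto simp: inj_on_def)
  have "image_mset card (mset_set ((`) f ` \<G>)) = image_mset card (image_mset ((`) f) (mset_set \<G>))"
    using injG by (simp add: image_mset_mset_set)
  also have "\<dots> = image_mset card (mset_set \<G>)"
  proof -
    have "finite \<G>" using gd(1,3) by (rule finite_elements)
    then show ?thesis unfolding image_mset.compositionality
      by (intro image_mset_cong) (auto simp: card_im GV)
  qed
  finally have ms: "image_mset card (mset_set ((`) f ` \<G>)) = (\<Sum>(g, u)\<leftarrow>T. replicate_mset u g)"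
    using gd(4) by simp
  have part: "partition_on (f ` V) ((`) f ` \<G>)"
  proof (rule partition_onI)
    show "\<Union> ((`) f ` \<G>) = f ` V" using partition_onD1[OF gd(3)] by blast
    show "{} \<notin> (`) f ` \<G>" using partition_onD3[OF gd(3)] by auto
    fix p q assume "p \<in> (`) f ` \<G>" "q \<in> (`) f ` \<G>" "p \<noteq> q"
    then obtain G H where GH: "G \<in> \<G>" "H \<in> \<G>" "G \<noteq> H" "p = f ` G" "q = f ` H" by blast
    then have "G \<inter> H = {}"
      using partition_onD2[OF gd(3)] by (meson disjointD)
    then show "disjnt p q"
      using GH inj_on_image_Int[OF inj, of G H] GV by (auto simp: disjnt_def)
  qed
  have diff: "\<exists>!B'. B' \<in> (`) f ` \<B> \<and> {a, b} \<subseteq> B'"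
    if G: "G \<in> \<G>" and H: "H \<in> \<G>" and "f ` G \<noteq> f ` H" and a: "a \<in> f ` G" and b: "b \<in> f ` H" for G H a b
  proof -
    obtain x y where xy: "x \<in> G" "y \<in> H" "a = f x" "b = f y" using a b by auto
    then have V: "x \<in> V" "y \<in> V" using GV G H by auto
    have "G \<noteq> H" using that(3) by auto
    from cross[OF G H this xy(1,2)]
    obtain B where B: "B \<in> \<B>" "{x, y} \<subseteq> B" and un: "\<And>C. C \<in> \<B> \<and> {x, y} \<subseteq> C \<Longrightarrow> C = B"
      by (elim ex1E conjE) blast
    show ?thesis
    proof (rule ex1I[of _ "f ` B"])
      show "f ` B \<in> (`) f ` \<B> \<and> {a, b} \<subseteq> f ` B" using B xy by auto
      fix C' assume C': "C' \<in> (`) f ` \<B> \<and> {a, b} \<subseteq> C'"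
      then obtain C where "C \<in> \<B>" "C' = f ` C" by auto
      then have "{x, y} \<subseteq> C" using C' xy(3,4) mem[OF V(1) blk(1)] mem[OF V(2) blk(1)] by auto
      then show "C' = f ` B" using un[of C] \<open>C \<in> \<B>\<close> \<open>C' = f ` C\<close> by simp
    qed
  qed
  have same: "\<not> (\<exists>B'\<in>(`) f ` \<B>. {a, b} \<subseteq> B')"
    if G: "G \<in> \<G>" and a: "a \<in> f ` G" and b: "b \<in> f ` G" and ne: "a \<noteq> b" for G a b
  proof -
    obtain x y where xy: "x \<in> G" "y \<in> G" "a = f x" "b = f y" using a b by auto
    then have "x \<in> V" "y \<in> V" "x \<noteq> y" using GV G ne by auto
    then show ?thesis using within[OF G xy(1,2)] xy(3,4) mem blk(1) by auto
  qed
  show ?thesis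
    unfolding gdd_def split
  proof (intro conjI)
    show "\<forall>B\<in>(`) f ` \<B>. B \<subseteq> f ` V \<and> card B = k"
      using blk card_im by (auto simp: image_mono)
    show "\<forall>G\<in>(`) f ` \<G>. \<forall>H\<in>(`) f ` \<G>. G \<noteq> H \<longrightarrow>
        (\<forall>a\<in>G. \<forall>b\<in>H. \<exists>!B. B \<in> (`) f ` \<B> \<and> {a, b} \<subseteq> B)"
    proof (intro ballI impI)
      fix G' H' a b
      assume G': "G' \<in> (`) f ` \<G>" and H': "H' \<in> (`) f ` \<G>"
      obtain G H where "G \<in> \<G>" "G' = f ` G" "H \<in> \<G>" "H' = f ` H" using G' H' by (elim imageE)
      moreover assume "G' \<noteq> H'" "a \<in> G'" "b \<in> H'"
      ultimately show "\<exists>!B'. B' \<in> (`) f ` \<B> \<and> {a, b} \<subseteq> B'" using diff[of G H a b] by simp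
    qed
    show "\<forall>G\<in>(`) f ` \<G>. \<forall>a\<in>G. \<forall>b\<in>G. a \<noteq> b \<longrightarrow> \<not> (\<exists>B\<in>(`) f ` \<B>. {a, b} \<subseteq> B)"
    proof (intro ballI impI)
      fix G' a b
      assume "G' \<in> (`) f ` \<G>" "a \<in> G'" "b \<in> G'" "a \<noteq> b"
      then show "\<not> (\<exists>B'\<in>(`) f ` \<B>. {a, b} \<subseteq> B')" using same by (elim imageE) metis
    qed
  qed (use gd(1,2,5) part ms card_im[of V] in simp_all)
qed

section \<open>Points in cyclic orbits\<close>

type_synonym point = "int \<times> int"

text \<open>
An entry \<open>(n, l, c, h, d)\<close> describes \<open>n\<close> consecutive point orbits of length \<open>l\<close>. They are taken \<open>h\<close> at a
time: the first \<open>h\<close> meet the same groups, so do the next \<open>h\<close>, and so on. The groups met by such a bunch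
are permuted cyclically and are \<open>d\<close> in number. They form a class, and \<open>c\<close> is the number of the first
class that the entry refers to. Different entries may refer to the same class, because a group that
the translations fix may consist of orbits of different lengths.
\<close>
type_synonym orbits = "(int \<times> int \<times> int \<times> int \<times> int) list"

text \<open>
An entry \<open>(r, Cs)\<close> lists base blocks that are invariant under translation by \<open>r\<close>, so that each of
them has at most \<open>r\<close> translates. A long list of base blocks is cut into several entries because
rewriting inspects the whole rest of a list at every step, which makes the cost quadratic in its
length.
\<close>
type_synonym base = "(int \<times> point list list) list"

text \<open>
The length, the class, and the number of groups of the class. The value for an index out of range
satisfies the requirements of \<open>proper\<close>, which spares side conditions on indices.
\<close>
fun orbit :: "orbits \<Rightarrow> int \<Rightarrow> int \<times> int \<times> int" where
  "orbit [] i = (1, 0, 1)"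
| "orbit ((n, l, c, h, d) # T) i = (if i < n then (l, c + i div h, d) else orbit T (i - n))"

definition orbit_indices :: "orbits \<Rightarrow> int list" where
  "orbit_indices T = [0..sum_list (map fst T) - 1]"

text \<open>
The label identifies the group of a point. Coordinates are chosen such that all points \<open>(i, 0)\<close> of one
class are in the same group; translation then moves from group to group modulo \<open>d\<close>.
\<close>
fun label :: "orbits \<Rightarrow> point \<Rightarrow> int \<times> int \<times> int" where
  "label T (i, x) = (case orbit T i of (l, c, d) \<Rightarrow> (c, d, x mod d))"

fun shift :: "orbits \<Rightarrow> int \<Rightarrow> point \<Rightarrow> point" where
  "shift T k (i, x) = (i, (x + k) mod fst (orbit T i))"

definition points :: "orbits \<Rightarrow> point list" where
  "points T = concat (map (\<lambda>i. map (Pair i) [0..fst (orbit T i) - 1]) (orbit_indices T))"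

text \<open>
The points outside the group of \<open>(i, 0)\<close>, produced in increasing order and without evaluating the
labels of all points.
\<close>
definition far_points :: "orbits \<Rightarrow> int \<Rightarrow> point list" where
  "far_points T i = concat (map (\<lambda>j. map (Pair j)
     (if snd (orbit T j) = snd (orbit T i)
      then filter (\<lambda>x. x mod snd (snd (orbit T j)) \<noteq> 0) [0..fst (orbit T j) - 1]
      else [0..fst (orbit T j) - 1])) (orbit_indices T))"

definition proper :: "orbits \<Rightarrow> bool" where
  "proper T \<longleftrightarrow> list_all (\<lambda>(n, l, c, h, d). 0 < l \<and> 0 < d \<and> l mod d = 0) T"

lemma in_points: "(i, x) \<in> set (points T) \<longleftrightarrow>
    0 \<le> i \<and> i < sum_list (map fst T) \<and> 0 \<le> x \<and> x < fst (orbit T i)"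
  by (force simp: points_def orbit_indices_def)

lemma distinct_concat_map_Pair:
  "distinct js \<Longrightarrow> (\<And>i. i \<in> set js \<Longrightarrow> distinct (f i)) \<Longrightarrow> distinct (concat (map (\<lambda>i. map (Pair i) (f i)) js))"
  by (induction js) (auto simp: distinct_map inj_on_def)

lemma distinct_points: "distinct (points T)"
  unfolding points_def by (rule distinct_concat_map_Pair) (auto simp: orbit_indices_def)

lemma distinct_far_points: "distinct (far_points T i)"
  unfolding far_points_def by (rule distinct_concat_map_Pair) (auto simp: orbit_indices_def)

lemma set_far_points: "set (far_points T i) = {q \<in> set (points T). label T q \<noteq> label T (i, 0)}"
proof -
  have "(j, y) \<in> set (far_points T i) \<longleftrightarrow> (j, y) \<in> set (points T) \<and> label T (j, y) \<noteq> label T (i, 0)" for j y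
  proof -
    have "(j, y) \<in> set (far_points T i) \<longleftrightarrow> 0 \<le> j \<and> j < sum_list (map fst T) \<and>
        y \<in> set (if snd (orbit T j) = snd (orbit T i)
                 then filter (\<lambda>x. x mod snd (snd (orbit T j)) \<noteq> 0) [0..fst (orbit T j) - 1]
                 else [0..fst (orbit T j) - 1])"
      unfolding far_points_def orbit_indices_def by force
    then show ?thesis
      unfolding in_points by (cases "orbit T j"; cases "orbit T i") auto
  qed
  then show ?thesis by auto
qed

lemma shift_shift: "shift T a (shift T b p) = shift T (a + b) p"
  by (cases p) (simp add: mod_simps algebra_simps)

context
  fixes T :: orbits
  assumes proper: "proper T"
begin

lemma orbit_proper: "case orbit T i of (l, c, d) \<Rightarrow> 0 < l \<and> 0 < d \<and> d dvd l"
  using proper by (induction T i rule: orbit.induct) (auto simp: proper_def)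

lemma shift_in: "p \<in> set (points T) \<Longrightarrow> shift T k p \<in> set (points T)"
  using orbit_proper[of "fst p"] by (cases p) (auto simp: in_points)

lemma shift_0: "p \<in> set (points T) \<Longrightarrow> shift T 0 p = p"
  by (cases p) (auto simp: in_points)

lemma inj_shift: "inj_on (shift T k) (set (points T))"
  by (rule inj_on_inverseI[of _ "shift T (- k)"]) (simp add: shift_shift shift_0)

text \<open>
Translations permute the groups, because \<open>d\<close> divides the length of the orbit.
\<close>
lemma label_shift:
  assumes p: "p \<in> set (points T)" and q: "q \<in> set (points T)"
  shows "label T (shift T k p) = label T (shift T k q) \<longleftrightarrow> label T p = label T q"
proof -
  obtain i x j y where ij: "p = (i, x)" "q = (j, y)" by (cases p, cases q)
  obtain l c d l' c' d' where T: "orbit T i = (l, c, d)" "d dvd l" "orbit T j = (l', c', d')" "d' dvd l'"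
    using orbit_proper[of i] orbit_proper[of j] by (cases "orbit T i"; cases "orbit T j") auto
  have "(x + k) mod d = (y + k) mod d \<longleftrightarrow> x mod d = y mod d"
    by (simp add: mod_eq_dvd_iff)
  then show ?thesis using T by (auto simp: ij mod_mod_cancel)
qed

text \<open>
The translate by \<open>k\<close> depends only on \<open>k mod r\<close>.
\<close>
lemma card_translates:
  assumes B: "set B \<subseteq> set (points T)" and r: "0 < r" and per: "shift T r ` set B \<subseteq> set B"
  shows "card (range (\<lambda>k. shift T k ` set B)) \<le> nat r"
proof -
  have eq: "shift T r ` set B = set B"
    using per inj_on_subset[OF inj_shift B, of r] by (simp add: card_subset_eq card_image)
  have add: "shift T (k + r) ` set B = shift T k ` set B" for k
    using arg_cong[OF eq, of "\<lambda>A. shift T k ` A"] by (simp add: image_image shift_shift)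
  have addn: "shift T (k + int n * r) ` set B = shift T k ` set B" for k n
  proof (induction n)
    case (Suc n)
    have "k + int (Suc n) * r = (k + int n * r) + r" by (simp add: algebra_simps)
    then show ?case using add[of "k + int n * r"] Suc by (simp only:)
  qed simp
  have mod: "shift T k ` set B = shift T (k mod r) ` set B" for k
  proof (cases "k div r \<ge> 0")
    case True
    then show ?thesis using addn[of "k mod r" "nat (k div r)"] by (simp add: mod_mult_div_eq add.commute)
  next
    case False
    have "k + - (k div r) * r = k mod r" by (simp add: minus_div_mult_eq_mod[symmetric])
    then show ?thesis using addn[of k "nat (- (k div r))"] False by simp
  qed
  have "range (\<lambda>k. shift T k ` set B) \<subseteq> (\<lambda>k. shift T k ` set B) ` {0..<r}"
  proof (rule image_subsetI)
    show "shift T k ` set B \<in> (\<lambda>k. shift T k ` set B) ` {0..<r}" for k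
      by (rule image_eqI[where x = "k mod r"]) (rule mod, use r in simp)
  qed
  then have "card (range (\<lambda>k. shift T k ` set B)) \<le> card {0..<r}"
    using surj_card_le[of "{0..<r}"] by blast
  then show ?thesis by simp
qed

end

section \<open>Translates of base blocks\<close>

definition translates :: "orbits \<Rightarrow> base \<Rightarrow> point set set" where
  "translates T Bs = (\<Union>(r, Cs)\<in>set Bs. \<Union>B\<in>set Cs. range (\<lambda>k. shift T k ` set B))"

lemma card_UN_list: "card (\<Union>x\<in>set xs. f x) \<le> (\<Sum>x\<leftarrow>xs. card (f x))"
proof (induction xs)
  case (Cons a xs)
  then show ?case using card_Un_le[of "f a" "\<Union>x\<in>set xs. f x"] by simp
qed simp

text \<open>
Links are sorted by a bottom-up merge sort, so that coverage becomes an equality of lists. Soundness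
rests on the set of elements of the result alone.
\<close>
fun merge :: "point list \<Rightarrow> point list \<Rightarrow> point list" where
  "merge [] qs = qs"
| "merge ps [] = ps"
| "merge ((i, x) # ps) ((j, y) # qs) =
    (if i < j \<or> i = j \<and> x \<le> y then (i, x) # merge ps ((j, y) # qs)
     else (j, y) # merge ((i, x) # ps) qs)"

fun merge_pairs :: "point list list \<Rightarrow> point list list" where
  "merge_pairs (ps # qs # pss) = merge ps qs # merge_pairs pss"
| "merge_pairs pss = pss"

lemma length_merge_pairs: "length (merge_pairs pss) \<le> length pss"
  by (induction pss rule: merge_pairs.induct) auto

function merge_all :: "point list list \<Rightarrow> point list" where
  "merge_all [] = []"
| "merge_all [ps] = ps"
| "merge_all (ps # qs # pss) = merge_all (merge_pairs (ps # qs # pss))"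
  by pat_completeness auto
termination by (relation "measure length") (auto simp: le_imp_less_Suc length_merge_pairs)

lemma set_merge: "set (merge ps qs) = set ps \<union> set qs"
  by (induction ps qs rule: merge.induct) auto

lemma set_merge_pairs: "(\<Union>ps\<in>set (merge_pairs pss). set ps) = (\<Union>ps\<in>set pss. set ps)"
  by (induction pss rule: merge_pairs.induct) (auto simp: set_merge)

lemma set_merge_all: "set (merge_all pss) = (\<Union>ps\<in>set pss. set ps)"
proof (induction pss rule: merge_all.induct)
  case (3 ps qs pss)
  then show ?case using set_merge_pairs[of "ps # qs # pss"] by (simp del: merge_pairs.simps)
qed auto

text \<open>
The points joined with \<open>(i, 0)\<close> by a translate of \<open>B\<close>. A translate through \<open>(i, 0)\<close> arises by moving some
\<open>(i, y)\<close> of \<open>B\<close> to the origin. If the orbit is shorter than the period \<open>r\<close>, several translations do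
this; they differ by multiples of the length of the orbit. If \<open>r\<close> is at most that length, only \<open>t = 0\<close>
occurs.
\<close>
definition star :: "orbits \<Rightarrow> int \<Rightarrow> int \<Rightarrow> point list \<Rightarrow> point list" where
  "star T i r B = concat (map (\<lambda>(j, y). if j = i then
     concat (map (\<lambda>t. map (shift T (t * fst (orbit T i) - y)) (removeAll (j, y) B))
       [0..(r - 1) div fst (orbit T i)]) else []) B)"

lemma star_sound:
  assumes "q \<in> set (star T i r B)"
  shows "\<exists>k. (i, 0) \<in> shift T k ` set B \<and> q \<in> shift T k ` set B"
proof -
  from assms obtain y t z where *: "(i, y) \<in> set B" "z \<in> set B" "q = shift T (t * fst (orbit T i) - y) z"
    by (auto simp: star_def split: if_splits)
  have "shift T (t * fst (orbit T i) - y) (i, y) = (i, 0)" by simp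
  then show ?thesis using * by (metis image_eqI)
qed

definition link :: "orbits \<Rightarrow> base \<Rightarrow> int \<Rightarrow> point list" where
  "link T Bs i = merge_all (concat (map (\<lambda>(r, Cs). concat (map (\<lambda>B. map (\<lambda>p. [p]) (star T i r B)) Cs)) Bs))"

text \<open>
Repetitions in a link are tolerated: a block with a non-trivial stabiliser is met once for each of
its points in the orbit. The lengths of the lists of far points show that all groups have size \<open>g\<close>.
\<close>
definition links_cover :: "nat \<Rightarrow> nat \<Rightarrow> orbits \<Rightarrow> base \<Rightarrow> bool" where
  "links_cover g u T Bs \<longleftrightarrow> list_all (\<lambda>i.
     int (length (far_points T i)) + int g = int u * int g \<and>
     remdups_adj (link T Bs i) = far_points T i) (orbit_indices T)"

text \<open>
The last equation says that the translates are not more numerous than the blocks of a design.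
\<close>
definition well_formed :: "nat \<Rightarrow> nat \<Rightarrow> nat \<Rightarrow> orbits \<Rightarrow> base \<Rightarrow> bool" where
  "well_formed k g u T Bs \<longleftrightarrow>
     proper T \<and> int (length (points T)) = int u * int g \<and>
     list_all (\<lambda>(r, Cs). 0 < r \<and> list_all (\<lambda>B. length B = k \<and> distinct B \<and>
       list_all (\<lambda>(i, x). 0 \<le> i \<and> i < sum_list (map fst T) \<and> 0 \<le> x \<and> x < fst (orbit T i)) B \<and>
       list_all (\<lambda>p. p \<in> set B) (map (shift T r) B)) Cs) Bs \<and>
     sum_list (map (\<lambda>(r, Cs). r * int (length Cs)) Bs) * (int k * (int k - 1))
       = int u * int g * (int u * int g - int g)"

text \<open>
Coverage at the origins of the orbits spreads to all cross pairs by translation, and the sum of the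
periods bounds the number of translates, so the counting argument applies.
\<close>
theorem gdd_if_checked:
  assumes wf: "well_formed k g u T Bs" and cov: "links_cover g u T Bs"
    and k: "0 < k" and g: "0 < g" and u: "1 < u"
  shows "\<exists>(V :: nat set) \<G> \<B>. gdd k [(g, u)] (V, \<G>, \<B>)"
proof -
  define V where "V = set (points T)"
  define \<B> where "\<B> = translates T Bs"
  have T: "proper T" using wf by (simp add: well_formed_def)
  note shift_in = shift_in[OF T] and shift_0 = shift_0[OF T] and inj = inj_shift[OF T]
    and label_shift = label_shift[OF T]
  have "int (card V) = int u * int g"
    using wf by (simp add: V_def distinct_card[OF distinct_points] well_formed_def)
  then have cardV: "card V = u * g" by (metis of_nat_eq_iff of_nat_mult)
  have base: "set B \<subseteq> V \<and> card (set B) = k \<and> 0 < r \<and> shift T r ` set B \<subseteq> set B"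
    if "(r, Cs) \<in> set Bs" "B \<in> set Cs" for B r Cs
  proof -
    have *: "0 < r" "length B = k" "distinct B" "\<And>p. p \<in> set B \<Longrightarrow> shift T r p \<in> set B"
      "\<And>i x. (i, x) \<in> set B \<Longrightarrow> 0 \<le> i \<and> i < sum_list (map fst T) \<and> 0 \<le> x \<and> x < fst (orbit T i)"
      using wf that by (fastforce simp: well_formed_def list_all_iff)+
    then show ?thesis by (auto simp: V_def in_points distinct_card)
  qed
  have blocks: "B' \<subseteq> V \<and> card B' = k" if "B' \<in> \<B>" for B'
  proof -
    from that obtain B r Cs m where B: "(r, Cs) \<in> set Bs" "B \<in> set Cs" "B' = shift T m ` set B"
      by (auto simp: \<B>_def translates_def)
    then show ?thesis
      using base[OF B(1,2)] shift_in inj_on_subset[OF inj] by (auto simp: V_def card_image)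
  qed
  have cov_i: "int (length (far_points T i)) + int g = int u * int g"
      "set (link T Bs i) = {q \<in> V. label T q \<noteq> label T (i, 0)}" if "(i, 0) \<in> V" for i
  proof -
    have *: "int (length (far_points T i)) + int g = int u * int g \<and>
        remdups_adj (link T Bs i) = far_points T i"
      using cov that by (auto simp: links_cover_def list_all_iff V_def in_points orbit_indices_def)
    then show "int (length (far_points T i)) + int g = int u * int g" ..
    have "set (link T Bs i) = set (remdups_adj (link T Bs i))" by simp
    also have "\<dots> = {q \<in> V. label T q \<noteq> label T (i, 0)}"
      using * by (simp only: set_far_points V_def)
    finally show "set (link T Bs i) = {q \<in> V. label T q \<noteq> label T (i, 0)}" .
  qed
  have origin: "(i, 0) \<in> V" if "(i, x) \<in> V" for i x
    using that by (auto simp: V_def in_points)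
  have to_origin: "shift T (- x) (i, x) = (i, 0)" "shift T x (i, 0) = (i, x)" if "(i, x) \<in> V" for i x
    using that by (auto simp: V_def in_points)
  have size: "card {q \<in> V. label T q = label T p} = g" if "p \<in> V" for p
  proof -
    obtain i x where p: "p = (i, x)" by (cases p)
    \<comment> \<open>A translation carries the group of \<open>p\<close> to that of \<open>(i, 0)\<close>, the complement of \<open>far_points T i\<close>.\<close>
    define Z where "Z = {q \<in> V. label T q = label T (i, 0)}"
    have V0: "(i, 0) \<in> V" using origin that p by blast
    have "{q \<in> V. label T q = label T p} = shift T x ` Z"
    proof (intro equalityI subsetI)
      fix q assume q: "q \<in> {q \<in> V. label T q = label T p}"
      then have "shift T (- x) q \<in> Z"
        using label_shift[of q p "- x"] to_origin[of i x] that p shift_in by (auto simp: Z_def V_def)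
      moreover have "q = shift T x (shift T (- x) q)" using q by (simp add: shift_shift shift_0 V_def)
      ultimately show "q \<in> shift T x ` Z" by blast
    next
      fix q assume "q \<in> shift T x ` Z"
      then show "q \<in> {q \<in> V. label T q = label T p}"
        using label_shift[of _ "(i, 0)" x] to_origin[of i x] V0 that p shift_in by (auto simp: Z_def V_def)
    qed
    then have "card {q \<in> V. label T q = label T p} = card Z"
      using inj_on_subset[OF inj, of Z x] by (auto simp: card_image Z_def V_def)
    moreover have "card Z + card (set (far_points T i)) = card V"
      unfolding Z_def V_def set_far_points
      by (subst card_Un_disjoint[symmetric]) (auto intro: arg_cong[where f = card])
    then have "int (card Z) + int (length (far_points T i)) = int u * int g"
      using distinct_card[OF distinct_far_points] cardV by (metis of_nat_add of_nat_mult)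
    ultimately show ?thesis using cov_i(1)[OF V0] by simp
  qed
  have cover: "\<exists>B\<in>\<B>. {p, q} \<subseteq> B" if "p \<in> V" "q \<in> V" "label T p \<noteq> label T q" for p q
  proof -
    obtain i x where p: "p = (i, x)" by (cases p)
    have V0: "(i, 0) \<in> V" using origin that p by blast
    \<comment> \<open>Move \<open>p\<close> to the origin of its orbit, take a block from the link there, and move back.\<close>
    define q' where "q' = shift T (- x) q"
    have q': "q' \<in> V" "shift T x q' = q"
      using that(2) shift_in by (auto simp: q'_def V_def shift_shift shift_0)
    have "label T q' \<noteq> label T (i, 0)"
      using label_shift[of q p "- x"] to_origin[of i x] that p by (auto simp: q'_def V_def)
    then have "q' \<in> set (link T Bs i)" using cov_i(2)[OF V0] q'(1) by simp
    then obtain r Cs B where B: "(r, Cs) \<in> set Bs" "B \<in> set Cs" "q' \<in> set (star T i r B)"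
      by (auto simp: link_def set_merge_all)
    from star_sound[OF B(3)]
    obtain m where m: "(i, 0) \<in> shift T m ` set B" "q' \<in> shift T m ` set B" by (elim exE conjE)
    have "shift T x (i, 0) = p" using to_origin(2) that(1) p by simp
    then have "p \<in> shift T x ` shift T m ` set B" "q \<in> shift T x ` shift T m ` set B"
      using imageI[OF m(1), of "shift T x"] imageI[OF m(2), of "shift T x"] q'(2) by simp_all
    then have "{p, q} \<subseteq> shift T (x + m) ` set B" by (simp add: image_image shift_shift)
    moreover have "shift T (x + m) ` set B \<in> \<B>"
      unfolding \<B>_def translates_def using B(1,2) by (intro UN_I[of "(r, Cs)"]) auto
    ultimately show ?thesis by blast
  qed
  have "int (card \<B>) \<le> sum_list (map (\<lambda>(r, Cs). r * int (length Cs)) Bs)"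
  proof -
    have "card (\<Union>B\<in>set Cs. range (\<lambda>k. shift T k ` set B)) \<le> nat r * length Cs"
      if "(r, Cs) \<in> set Bs" for r Cs
    proof -
      have "card (\<Union>B\<in>set Cs. range (\<lambda>k. shift T k ` set B))
          \<le> (\<Sum>B\<leftarrow>Cs. card (range (\<lambda>k. shift T k ` set B)))" by (rule card_UN_list)
      also have "\<dots> \<le> (\<Sum>B\<leftarrow>Cs. nat r)"
        using card_translates[OF T] base[OF that] by (intro sum_list_mono) (auto simp: V_def)
      finally show ?thesis by (simp add: sum_list_triv mult.commute)
    qed
    then have *: "card (case p of (r, Cs) \<Rightarrow> \<Union>B\<in>set Cs. range (\<lambda>k. shift T k ` set B))
        \<le> nat (fst p) * length (snd p)" if "p \<in> set Bs" for p
      using that by (cases p) auto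
    have "card \<B> \<le> (\<Sum>p\<leftarrow>Bs. card (case p of (r, Cs) \<Rightarrow> \<Union>B\<in>set Cs. range (\<lambda>k. shift T k ` set B)))"
      unfolding \<B>_def translates_def by (rule card_UN_list)
    also have "\<dots> \<le> (\<Sum>p\<leftarrow>Bs. nat (fst p) * length (snd p))"
      using * by (rule sum_list_mono)
    finally have "int (card \<B>) \<le> int (\<Sum>p\<leftarrow>Bs. nat (fst p) * length (snd p))" by simp
    also have "\<dots> = (\<Sum>p\<leftarrow>Bs. int (nat (fst p) * length (snd p)))"
      by (simp add: sum_list_of_nat[symmetric] o_def del: of_nat_mult)
    also have "\<dots> = sum_list (map (\<lambda>(r, Cs). r * int (length Cs)) Bs)"
      using wf by (intro arg_cong[where f = sum_list] map_cong) (auto simp: well_formed_def list_all_iff)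
    finally show ?thesis .
  qed
  then have "int (card \<B>) * (int k * (int k - 1))
      \<le> sum_list (map (\<lambda>(r, Cs). r * int (length Cs)) Bs) * (int k * (int k - 1))"
    using k by (intro mult_right_mono) auto
  also have "\<dots> = int u * int g * (int u * int g - int g)"
    using wf by (simp add: well_formed_def)
  finally have "int (card \<B>) * (int k * (int k - 1)) \<le> int u * int g * (int u * int g - int g)" .
  moreover have "int k * (int k - 1) = int (k * (k - 1))"
    using k by (simp add: of_nat_diff)
  moreover have "int u * int g * (int u * int g - int g) = int (card V * (card V - g))"
  proof -
    have "g \<le> card V" using cardV u by simp
    then have "int (card V - g) = int u * int g - int g" using cardV by (simp only: of_nat_diff of_nat_mult)
    then show ?thesis using cardV by simp
  qed
  ultimately have few: "card \<B> * (k * (k - 1)) \<le> card V * (card V - g)"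
    by (metis of_nat_le_iff of_nat_mult)
  have ne: "\<B> \<noteq> {}"
  proof
    assume "\<B> = {}"
    then have "Cs = []" if "(r, Cs) \<in> set Bs" for r Cs
      using that by (cases Cs) (force simp: \<B>_def translates_def)+
    then have "sum_list (map (\<lambda>(r, Cs). r * int (length Cs)) Bs) = sum_list (map (\<lambda>_. 0) Bs)"
      by (intro arg_cong[where f = sum_list] map_cong) auto
    then have "sum_list (map (\<lambda>(r, Cs). r * int (length Cs)) Bs) = 0" by simp
    then have "int u * int g * (int u * int g - int g) = 0" using wf by (simp add: well_formed_def)
    then show False using g u by (simp add: right_diff_distrib[symmetric] mult.commute)
  qed
  have "gdd k [(g, u)] (V, (\<lambda>p. {q \<in> V. label T q = label T p}) ` V, \<B>)"
    by (rule gdd_if_covering) (use cardV size ne k blocks few cover in \<open>auto simp: V_def\<close>)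
  then show ?thesis
    using gdd_inj_image[of k "[(g, u)]" V _ \<B> to_nat] by blast
qed

section \<open>The eight designs\<close>

text \<open>
The affine group of order 56 of the field with 8 elements acts on this design. It has two orbits on
the groups, of lengths 28 and 7. The translations are those of a subgroup of order 7.
\<close>
definition orbits_2_35 :: orbits where
  "orbits_2_35 = [(10, 7, 0, 2, 7)]"

definition base_2_35 :: base where
  "base_2_35 = [(7, [
    [(0,0),(0,1),(2,2),(4,4),(8,5)], [(0,0),(0,2),(1,3),(5,4),(7,3)],
    [(0,0),(0,3),(3,1),(6,4),(7,2)], [(0,0),(1,2),(1,4),(1,5),(9,5)],
    [(0,0),(1,6),(2,5),(6,5),(8,6)], [(0,0),(2,0),(3,6),(4,6),(9,0)]]),
   (7, [
    [(0,0),(2,3),(5,3),(6,0),(6,6)], [(0,0),(2,4),(3,0),(5,1),(8,1)],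
    [(0,0),(2,6),(5,5),(7,5),(9,2)], [(0,0),(3,2),(3,3),(6,3),(8,2)],
    [(0,0),(3,4),(4,1),(5,0),(9,3)], [(0,0),(4,0),(6,2),(7,4),(8,0)]]),
   (7, [
    [(0,0),(4,2),(5,6),(7,0),(9,6)], [(0,0),(4,5),(8,3),(9,1),(9,4)],
    [(1,0),(2,0),(2,5),(7,1),(8,5)], [(1,0),(2,1),(4,6),(5,2),(6,3)],
    [(1,0),(2,2),(2,3),(3,0),(3,4)], [(1,0),(2,4),(5,0),(6,2),(9,5)]]),
   (7, [
    [(1,0),(3,1),(3,3),(7,6),(9,6)], [(1,0),(3,2),(5,4),(5,6),(7,2)],
    [(1,0),(3,5),(4,0),(4,1),(4,3)], [(1,0),(3,6),(4,5),(6,5),(8,2)],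
    [(1,0),(4,2),(5,3),(6,1),(9,2)], [(1,0),(4,4),(7,4),(7,5),(8,6)]]),
   (7, [
    [(1,0),(5,5),(8,1),(8,3),(8,4)], [(1,0),(6,0),(6,4),(7,3),(9,4)],
    [(2,0),(2,3),(4,4),(7,0),(9,2)], [(2,0),(4,0),(5,2),(5,5),(8,6)],
    [(2,0),(4,3),(6,1),(7,2),(7,5)], [(2,0),(6,6),(8,2),(9,4),(9,5)]]),
   (7, [
    [(3,0),(4,1),(6,2),(6,4),(8,4)], [(3,0),(5,0),(7,2),(7,4),(8,2)],
    [(3,0),(5,5),(5,6),(6,5),(9,0)], [(3,0),(7,6),(8,5),(9,2),(9,4)]])]"

lemma gdd_2_35: "\<exists>(V :: nat set) \<G> \<B>. gdd 5 [(2, 35)] (V, \<G>, \<B>)"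
  by (rule gdd_if_checked[where T = orbits_2_35 and Bs = base_2_35]; code_simp)

text \<open>
The simple group of order 168 acts on this design, with orbits of lengths 42, 28 and 1 on the groups.
The subgroup of order 7 that is used here fixes both points of one group.
\<close>
definition orbits_2_71 :: orbits where
  "orbits_2_71 = [(20, 7, 0, 2, 7), (2, 1, 10, 2, 1)]"

definition base_2_71 :: base where
  "base_2_71 = [(7, [
    [(0,0),(0,1),(5,1),(9,0),(9,5)], [(0,0),(0,2),(7,3),(11,4),(19,6)],
    [(0,0),(0,3),(1,5),(6,0),(15,3)], [(0,0),(1,1),(5,5),(17,1),(17,3)],
    [(0,0),(1,3),(16,2),(16,6),(18,5)], [(0,0),(1,4),(4,0),(12,6),(19,2)],
    [(0,0),(1,6),(5,4),(14,2),(17,4)], [(0,0),(2,0),(7,5),(9,3),(21,0)],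
    [(0,0),(2,1),(3,3),(15,6),(18,2)], [(0,0),(2,2),(4,1),(4,5),(7,6)],
    [(0,0),(2,3),(3,1),(15,2),(15,5)], [(0,0),(2,4),(6,5),(8,0),(20,0)]]),
   (7, [
    [(0,0),(2,5),(8,2),(8,5),(14,1)], [(0,0),(2,6),(4,3),(8,1),(13,5)],
    [(0,0),(3,0),(12,2),(14,3),(18,3)], [(0,0),(3,2),(3,4),(10,1),(10,4)],
    [(0,0),(3,5),(13,4),(15,4),(16,0)], [(0,0),(3,6),(7,0),(15,1),(18,6)],
    [(0,0),(4,2),(6,1),(13,3),(17,6)], [(0,0),(4,4),(4,6),(9,2),(14,0)],
    [(0,0),(5,2),(12,0),(14,4),(16,4)], [(0,0),(5,3),(13,2),(17,2),(18,0)],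
    [(0,0),(5,6),(11,3),(14,6),(17,0)], [(0,0),(6,2),(9,1),(10,6),(16,5)]]),
   (7, [
    [(0,0),(6,3),(12,1),(13,6),(19,3)], [(0,0),(6,6),(11,1),(13,0),(16,1)],
    [(0,0),(7,2),(10,2),(17,5),(18,4)], [(0,0),(7,4),(10,0),(14,5),(19,1)],
    [(0,0),(8,3),(12,4),(12,5),(19,5)], [(0,0),(8,4),(8,6),(10,3),(11,0)],
    [(0,0),(10,5),(11,6),(12,3),(19,0)], [(0,0),(11,5),(13,1),(16,3),(18,1)],
    [(1,0),(1,1),(3,2),(4,1),(8,0)], [(1,0),(1,2),(8,3),(14,0),(14,4)],
    [(1,0),(1,3),(3,6),(10,2),(18,1)], [(1,0),(2,0),(15,3),(16,0),(17,6)]]),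
   (7, [
    [(1,0),(2,1),(5,6),(7,1),(13,2)], [(1,0),(2,2),(2,4),(5,1),(11,1)],
    [(1,0),(2,3),(9,4),(10,0),(11,3)], [(1,0),(2,5),(3,4),(12,4),(17,3)],
    [(1,0),(2,6),(12,1),(16,1),(19,6)], [(1,0),(3,0),(9,2),(13,1),(15,0)],
    [(1,0),(3,5),(4,5),(11,6),(13,3)], [(1,0),(4,2),(17,4),(18,6),(19,2)],
    [(1,0),(4,4),(6,4),(8,4),(9,6)], [(1,0),(4,6),(12,0),(15,6),(18,0)],
    [(1,0),(5,0),(7,5),(10,3),(20,0)], [(1,0),(5,2),(6,5),(11,5),(21,0)]]),
   (7, [
    [(1,0),(5,3),(7,0),(7,2),(16,4)], [(1,0),(6,0),(14,1),(15,4),(17,1)],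
    [(1,0),(6,1),(6,3),(7,6),(12,3)], [(1,0),(6,6),(10,1),(12,5),(18,4)],
    [(1,0),(7,3),(9,0),(13,0),(18,3)], [(1,0),(7,4),(11,0),(12,6),(16,2)],
    [(1,0),(8,2),(9,1),(11,2),(15,2)], [(1,0),(8,5),(11,4),(13,4),(19,3)],
    [(1,0),(9,3),(13,5),(13,6),(19,0)], [(1,0),(9,5),(10,4),(16,5),(19,4)],
    [(1,0),(10,5),(14,6),(15,1),(19,1)], [(2,0),(2,1),(5,1),(6,0),(16,5)]]),
   (7, [
    [(2,0),(2,3),(11,1),(18,5),(18,6)], [(2,0),(3,1),(14,0),(14,1),(16,6)],
    [(2,0),(3,3),(3,4),(9,4),(19,5)], [(2,0),(4,0),(12,4),(14,4),(17,0)],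
    [(2,0),(4,1),(6,2),(7,1),(10,0)], [(2,0),(4,2),(14,2),(15,0),(19,1)],
    [(2,0),(4,5),(5,3),(12,3),(15,1)], [(2,0),(5,2),(10,3),(13,4),(19,2)],
    [(2,0),(6,3),(10,2),(14,5),(17,3)], [(2,0),(6,4),(9,5),(12,5),(16,3)],
    [(2,0),(6,5),(17,4),(18,0),(19,4)], [(2,0),(7,2),(8,1),(12,0),(14,6)]]),
   (7, [
    [(2,0),(7,3),(11,2),(13,3),(17,1)], [(2,0),(7,6),(10,1),(11,3),(19,6)],
    [(2,0),(8,5),(9,2),(9,6),(12,1)], [(2,0),(8,6),(10,6),(13,2),(16,1)],
    [(2,0),(9,0),(15,4),(18,4),(19,3)], [(2,0),(10,5),(13,0),(13,5),(17,2)],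
    [(3,0),(3,3),(7,6),(8,2),(17,3)], [(3,0),(4,1),(5,4),(19,5),(19,6)],
    [(3,0),(4,2),(8,3),(10,5),(21,0)], [(3,0),(4,3),(9,3),(11,6),(20,0)],
    [(3,0),(4,4),(5,1),(16,6),(19,0)], [(3,0),(4,5),(11,2),(11,3),(18,4)]]),
   (7, [
    [(3,0),(5,0),(8,0),(16,0),(19,4)], [(3,0),(5,2),(12,6),(16,1),(18,1)],
    [(3,0),(5,3),(5,6),(6,3),(6,4)], [(3,0),(5,5),(13,3),(14,2),(19,3)],
    [(3,0),(6,0),(9,4),(10,1),(14,5)], [(3,0),(6,1),(7,2),(11,0),(11,4)],
    [(3,0),(6,2),(8,1),(17,4),(18,5)], [(3,0),(6,5),(7,0),(12,1),(17,2)],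
    [(3,0),(6,6),(8,4),(15,5),(16,3)], [(3,0),(7,4),(9,5),(13,2),(14,4)],
    [(3,0),(7,5),(13,4),(14,1),(16,4)], [(3,0),(9,6),(12,4),(13,0),(17,1)]]),
   (7, [
    [(3,0),(11,5),(12,3),(12,5),(17,5)], [(4,0),(4,1),(7,3),(16,4),(16,6)],
    [(4,0),(5,1),(5,6),(10,5),(17,3)], [(4,0),(5,2),(14,5),(18,0),(18,2)],
    [(4,0),(6,2),(7,6),(8,3),(17,5)], [(4,0),(6,3),(13,0),(13,3),(15,4)],
    [(4,0),(6,4),(9,4),(15,6),(18,3)], [(4,0),(6,5),(11,2),(13,4),(14,2)],
    [(4,0),(7,4),(8,4),(13,6),(15,2)], [(4,0),(8,2),(11,6),(12,0),(18,5)],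
    [(4,0),(9,1),(15,1),(16,0),(17,1)], [(4,0),(9,6),(10,0),(12,3),(14,6)]]),
   (7, [
    [(4,0),(10,1),(10,2),(11,0),(12,2)], [(4,0),(10,4),(16,1),(17,6),(19,1)],
    [(5,0),(5,1),(8,4),(11,2),(15,0)], [(5,0),(6,2),(9,5),(10,5),(18,3)],
    [(5,0),(7,0),(7,1),(8,2),(9,0)], [(5,0),(7,3),(12,3),(12,6),(15,3)],
    [(5,0),(8,1),(13,1),(14,1),(18,2)], [(5,0),(8,5),(9,1),(12,2),(15,4)],
    [(5,0),(8,6),(10,0),(13,4),(18,1)], [(5,0),(9,2),(11,6),(15,1),(16,3)],
    [(5,0),(9,3),(11,5),(14,6),(19,3)], [(5,0),(10,2),(12,1),(13,0),(15,2)]]),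
   (7, [
    [(6,0),(6,3),(11,1),(14,3),(19,1)], [(6,0),(8,3),(15,0),(19,2),(19,4)],
    [(6,0),(8,4),(12,4),(13,5),(14,6)], [(6,0),(9,5),(16,0),(16,1),(19,3)],
    [(6,0),(10,0),(15,5),(18,0),(18,4)], [(7,0),(7,3),(14,2),(18,1),(19,2)],
    [(7,0),(8,5),(18,3),(19,1),(19,5)], [(7,0),(9,2),(9,3),(17,0),(18,4)],
    [(7,0),(10,1),(15,2),(15,3),(17,1)], [(7,0),(10,4),(12,6),(13,3),(16,0)],
    [(7,0),(11,0),(14,5),(15,4),(15,6)], [(8,0),(8,1),(16,5),(17,0),(18,0)]]),
   (7, [
    [(8,0),(10,3),(10,5),(15,2),(16,3)], [(8,0),(11,2),(16,1),(17,4),(17,5)],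
    [(9,0),(10,2),(14,2),(14,4),(17,1)], [(9,0),(11,0),(12,3),(13,5),(18,0)],
    [(9,0),(11,5),(17,3),(17,6),(19,2)], [(11,0),(11,2),(14,6),(15,3),(16,3)],
    [(12,0),(14,5),(16,6),(18,3),(20,0)], [(12,0),(15,3),(17,5),(19,6),(21,0)],
    [(13,0),(14,3),(16,5),(18,6),(21,0)], [(13,0),(15,5),(17,6),(19,3),(20,0)]])]"

lemma gdd_2_71: "\<exists>(V :: nat set) \<G> \<B>. gdd 5 [(2, 71)] (V, \<G>, \<B>)"
  by (rule gdd_if_checked[where T = orbits_2_71 and Bs = base_2_71]; code_simp)

text \<open>
Besides the translations modulo 111, multiplication of all residues by 10 is an automorphism of
order 3. It fixes four of the 22 orbits of blocks under translation and permutes the others in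
cycles of length 3.
\<close>
definition orbits_2_111 :: orbits where
  "orbits_2_111 = [(2, 111, 0, 2, 111)]"

definition base_2_111 :: base where
  "base_2_111 = [(111, [
    [(0,0),(0,1),(0,41),(1,19),(1,105)], [(0,0),(0,2),(1,3),(1,49),(1,108)],
    [(0,0),(0,3),(0,19),(0,61),(1,75)], [(0,0),(0,4),(0,11),(1,24),(1,77)],
    [(0,0),(0,5),(0,18),(0,83),(1,68)]]),
   (111, [
    [(0,0),(0,6),(0,94),(1,40),(1,59)], [(0,0),(0,8),(0,59),(1,15),(1,94)],
    [(0,0),(0,9),(0,21),(0,47),(0,84)], [(0,0),(0,10),(0,77),(1,51),(1,79)],
    [(0,0),(0,14),(1,23),(1,25),(1,107)]]),
   (111, [
    [(0,0),(0,15),(0,54),(1,60),(1,97)], [(0,0),(0,20),(1,30),(1,46),(1,81)],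
    [(0,0),(0,22),(1,38),(1,55),(1,100)], [(0,0),(0,24),(0,56),(0,86),(1,29)],
    [(0,0),(0,29),(1,8),(1,28),(1,71)]]),
   (111, [
    [(0,0),(0,31),(0,66),(1,70),(1,83)], [(0,0),(0,43),(1,12),(1,87),(1,101)],
    [(0,0),(1,21),(1,31),(1,62),(1,92)], [(0,0),(1,22),(1,37),(1,91),(1,109)],
    [(0,0),(1,27),(1,36),(1,48),(1,74)]]),
   (111, [
    [(0,0),(1,32),(1,65),(1,88),(1,99)], [(0,0),(1,95),(1,98),(1,102),(1,103)]])]"

lemma gdd_2_111: "\<exists>(V :: nat set) \<G> \<B>. gdd 5 [(2, 111)] (V, \<G>, \<B>)"
  by (rule gdd_if_checked[where T = orbits_2_111 and Bs = base_2_111]; code_simp)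

text \<open>
The direct product of the alternating group of degree 5 and a group of order 3 acts on this design.
The product of an element of order 5 and one of order 3 gives the translations. The blocks of
period 3 consist of all five points of an orbit that have the same residue modulo 3.
\<close>
definition orbits_3_45 :: orbits where
  "orbits_3_45 = [(6, 15, 0, 3, 15), (3, 15, 2, 1, 5)]"

definition base_3_45 :: base where
  "base_3_45 = [(3, [
    [(3,0),(3,3),(3,6),(3,9),(3,12)], [(5,0),(5,3),(5,6),(5,9),(5,12)]]),
   (15, [
    [(0,0),(0,1),(1,7),(5,3),(7,14)], [(0,0),(0,2),(2,13),(7,7),(8,11)],
    [(0,0),(0,3),(3,0),(8,2),(8,4)], [(0,0),(0,4),(3,11),(4,0),(4,8)],
    [(0,0),(0,5),(6,10),(6,14),(8,10)], [(0,0),(0,6),(1,9),(4,12),(5,0)],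
    [(0,0),(0,7),(1,5),(5,5),(7,8)], [(0,0),(1,1),(3,2),(3,4),(5,6)]]),
   (15, [
    [(0,0),(1,2),(1,4),(1,11),(2,3)], [(0,0),(1,8),(2,5),(3,13),(6,2)],
    [(0,0),(1,10),(4,2),(4,3),(7,0)], [(0,0),(1,12),(2,10),(5,14),(6,3)],
    [(0,0),(1,14),(3,6),(3,14),(6,7)], [(0,0),(2,1),(2,8),(7,3),(8,13)],
    [(0,0),(2,2),(3,9),(5,4),(6,6)], [(0,0),(2,4),(6,4),(6,11),(7,11)]]),
   (15, [
    [(0,0),(2,6),(3,1),(4,14),(5,7)], [(0,0),(2,7),(3,5),(5,10),(6,1)],
    [(0,0),(2,9),(7,9),(7,12),(8,0)], [(0,0),(2,12),(4,1),(4,13),(7,2)],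
    [(0,0),(2,14),(6,0),(6,13),(7,10)], [(0,0),(3,3),(4,9),(8,8),(8,12)],
    [(0,0),(3,8),(4,10),(7,4),(8,3)], [(0,0),(3,10),(5,11),(6,8),(8,7)]]),
   (15, [
    [(0,0),(4,5),(5,1),(6,12),(8,6)], [(0,0),(4,7),(5,8),(5,12),(7,6)],
    [(1,0),(1,1),(5,14),(7,0),(8,0)], [(1,0),(1,3),(4,0),(8,4),(8,10)],
    [(1,0),(1,4),(3,8),(7,12),(8,6)], [(1,0),(1,5),(6,10),(7,11),(8,8)],
    [(1,0),(2,2),(2,6),(3,11),(7,10)], [(1,0),(2,3),(2,9),(3,6),(4,9)]]),
   (15, [
    [(1,0),(2,4),(5,10),(5,12),(6,2)], [(1,0),(2,5),(4,10),(4,14),(7,2)],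
    [(1,0),(2,8),(2,10),(3,12),(7,9)], [(1,0),(2,11),(3,2),(5,1),(5,9)],
    [(1,0),(3,9),(5,3),(8,9),(8,12)], [(1,0),(3,10),(3,14),(4,4),(6,4)],
    [(1,0),(3,13),(4,5),(6,13),(8,5)], [(1,0),(4,1),(6,11),(6,14),(7,1)]]),
   (15, [
    [(1,0),(4,2),(5,4),(6,7),(8,11)], [(1,0),(4,6),(6,3),(6,12),(8,13)],
    [(1,0),(4,11),(6,0),(7,4),(7,13)], [(1,0),(4,13),(5,7),(5,8),(6,1)],
    [(2,0),(2,1),(4,12),(4,14),(5,11)], [(2,0),(2,3),(5,0),(8,2),(8,10)],
    [(2,0),(2,5),(6,10),(6,11),(8,1)], [(2,0),(3,0),(3,14),(4,10),(7,6)]]),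
   (15, [
    [(2,0),(3,1),(4,2),(6,3),(8,0)], [(2,0),(3,11),(5,7),(6,2),(8,4)],
    [(2,0),(4,3),(5,9),(8,8),(8,9)], [(2,0),(4,7),(5,14),(7,13),(8,3)],
    [(3,0),(3,5),(7,8),(7,10),(8,6)], [(3,0),(4,8),(4,14),(5,12),(6,10)],
    [(3,0),(5,3),(6,3),(7,9),(8,11)], [(3,0),(5,8),(6,7),(7,0),(7,1)]]),
   (15, [
    [(3,0),(5,13),(6,14),(7,2),(7,13)], [(4,0),(4,5),(6,14),(7,10),(8,2)],
    [(5,0),(5,5),(7,2),(7,10),(8,3)]])]"

lemma gdd_3_45: "\<exists>(V :: nat set) \<G> \<B>. gdd 5 [(3, 45)] (V, \<G>, \<B>)"
  by (rule gdd_if_checked[where T = orbits_3_45 and Bs = base_3_45]; code_simp)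

text \<open>
The two base blocks of period 9 are cosets of the subgroup of order 5. They are needed because 45
does not divide the number 378 of blocks.
\<close>
definition orbits_6_15 :: orbits where
  "orbits_6_15 = [(2, 45, 0, 2, 15)]"

definition base_6_15 :: base where
  "base_6_15 = [(9, [
    [(0,0),(0,9),(0,18),(0,27),(0,36)], [(1,0),(1,9),(1,18),(1,27),(1,36)]]),
   (45, [
    [(0,0),(0,1),(1,3),(1,6),(1,25)], [(0,0),(0,2),(0,16),(1,10),(1,38)],
    [(0,0),(0,3),(0,23),(1,4),(1,44)], [(0,0),(0,4),(0,28),(0,39),(1,37)]]),
   (45, [
    [(0,0),(0,5),(0,37),(1,23),(1,34)], [(0,0),(0,7),(0,19),(1,14),(1,35)],
    [(0,0),(1,11),(1,13),(1,17),(1,27)], [(0,0),(1,12),(1,19),(1,20),(1,32)]])]"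

lemma gdd_6_15: "\<exists>(V :: nat set) \<G> \<B>. gdd 5 [(6, 15)] (V, \<G>, \<B>)"
  by (rule gdd_if_checked[where T = orbits_6_15 and Bs = base_6_15]; code_simp)

text \<open>
The direct product of the alternating group of degree 5 and a group of order 5 acts on this design,
with point stabilisers of order 2. The second factor fixes all groups and, together with an element
of order 3, generates the translations. (A cyclic group acting regularly on the 150 points is
impossible. Its involution would swap the two halves of the points according to parity, and the
blocks would fall into pairs with the same number, 0, 4 or 6, of pairs of opposite parity; but half
of the 5250 cross pairs of opposite parity is an odd number.)
\<close>
definition orbits_10_15 :: orbits where
  "orbits_10_15 = [(10, 15, 0, 2, 3)]"

definition base_10_15 :: base where
  "base_10_15 = [(15, [
    [(0,0),(0,1),(3,0),(5,12),(8,3)], [(0,0),(0,2),(5,7),(7,6),(9,11)],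
    [(0,0),(0,4),(2,14),(4,1),(7,0)], [(0,0),(0,5),(2,5),(4,14),(7,3)],
    [(0,0),(0,7),(3,3),(7,9),(8,12)], [(0,0),(1,1),(5,13),(5,14),(7,10)],
    [(0,0),(1,2),(6,2),(7,1),(9,13)], [(0,0),(1,4),(3,9),(4,13),(5,3)],
    [(0,0),(1,5),(3,13),(7,5),(9,3)]]),
   (15, [
    [(0,0),(1,7),(3,7),(8,4),(8,6)], [(0,0),(1,8),(3,10),(6,4),(8,10)],
    [(0,0),(1,10),(3,1),(4,7),(5,6)], [(0,0),(1,11),(6,5),(9,8),(9,10)],
    [(0,0),(1,13),(2,9),(4,0),(5,8)], [(0,0),(1,14),(2,12),(6,0),(9,2)],
    [(0,0),(2,1),(2,3),(8,9),(8,13)], [(0,0),(2,2),(3,4),(7,14),(8,11)],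
    [(0,0),(2,4),(5,2),(6,10),(6,12)]]),
   (15, [
    [(0,0),(2,6),(4,6),(4,11),(6,1)], [(0,0),(2,7),(4,5),(6,9),(7,7)],
    [(0,0),(2,8),(4,3),(4,4),(6,6)], [(0,0),(2,11),(5,4),(8,0),(9,7)],
    [(0,0),(2,13),(3,6),(5,9),(6,3)], [(0,0),(3,2),(5,1),(9,1),(9,12)],
    [(0,0),(3,5),(4,8),(6,8),(9,6)], [(0,0),(3,8),(4,10),(8,1),(9,0)],
    [(0,0),(3,12),(4,2),(7,8),(8,14)]]),
   (15, [
    [(0,0),(5,0),(6,7),(6,14),(9,14)], [(0,0),(5,10),(6,13),(8,8),(9,4)],
    [(0,0),(6,11),(7,12),(8,7),(9,5)], [(1,0),(1,1),(2,10),(7,5),(9,5)],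
    [(1,0),(1,2),(3,1),(3,9),(9,9)], [(1,0),(1,4),(4,11),(5,7),(6,3)],
    [(1,0),(1,5),(6,7),(8,1),(9,6)], [(1,0),(1,7),(2,4),(5,1),(7,8)],
    [(1,0),(2,0),(2,5),(3,4),(5,5)]]),
   (15, [
    [(1,0),(2,1),(6,5),(6,10),(8,3)], [(1,0),(2,2),(4,1),(8,9),(9,10)],
    [(1,0),(2,3),(5,4),(5,6),(6,4)], [(1,0),(2,6),(5,0),(8,4),(9,8)],
    [(1,0),(2,7),(4,8),(7,6),(7,13)], [(1,0),(2,8),(6,8),(8,8),(8,13)],
    [(1,0),(2,14),(3,12),(4,6),(7,2)], [(1,0),(3,3),(4,3),(4,14),(9,0)],
    [(1,0),(3,10),(5,2),(7,3),(7,7)]]),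
   (15, [
    [(1,0),(3,11),(4,4),(8,6),(8,7)], [(1,0),(3,13),(5,8),(6,12),(6,13)],
    [(1,0),(4,0),(7,10),(7,12),(8,10)], [(1,0),(4,5),(4,13),(6,6),(8,5)],
    [(1,0),(4,10),(7,11),(8,0),(9,2)], [(2,0),(2,1),(3,11),(6,12),(9,13)],
    [(2,0),(2,4),(3,5),(7,9),(8,3)], [(2,0),(2,7),(4,4),(9,6),(9,7)],
    [(2,0),(3,7),(4,8),(6,14),(9,3)]]),
   (15, [
    [(2,0),(4,3),(5,7),(7,11),(8,1)], [(2,0),(5,2),(7,8),(9,4),(9,9)],
    [(2,0),(5,4),(7,2),(7,7),(9,1)], [(2,0),(5,6),(5,10),(6,7),(8,11)],
    [(3,0),(3,1),(3,11),(6,6),(7,14)], [(3,0),(3,2),(5,6),(5,13),(8,6)],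
    [(3,0),(4,7),(5,2),(6,4),(8,1)], [(3,0),(4,10),(5,8),(7,2),(9,9)],
    [(3,0),(4,12),(4,14),(6,8),(9,3)]]),
   (15, [
    [(3,0),(4,13),(5,0),(9,6),(9,13)], [(3,0),(6,2),(6,13),(7,9),(8,5)],
    [(3,0),(6,11),(7,0),(7,1),(9,4)], [(4,0),(5,1),(7,3),(8,4),(8,11)],
    [(4,0),(5,7),(6,13),(7,0),(8,14)], [(4,0),(6,14),(7,9),(8,1),(9,11)],
    [(5,0),(5,5),(7,0),(8,2),(9,10)]])]"

lemma gdd_10_15: "\<exists>(V :: nat set) \<G> \<B>. gdd 5 [(10, 15)] (V, \<G>, \<B>)"
  by (rule gdd_if_checked[where T = orbits_10_15 and Bs = base_10_15]; code_simp)

text \<open>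
A group of order 275 acts on this design, the direct product of a non-abelian group of order 55 and a
group of order 5. It has two orbits of 11 groups each and one fixed group; its elements of order 55
induce the translations.
\<close>
definition orbits_10_23 :: orbits where
  "orbits_10_23 = [(4, 55, 0, 2, 11), (2, 5, 2, 2, 1)]"

definition base_10_23 :: base where
  "base_10_23 = [(55, [
    [(0,0),(0,1),(0,13),(0,29),(0,37)], [(0,0),(0,2),(2,6),(2,40),(2,43)],
    [(0,0),(0,3),(2,27),(2,31),(2,54)], [(0,0),(0,4),(1,52),(2,9),(3,11)],
    [(0,0),(0,5),(1,3),(1,42),(3,21)], [(0,0),(0,6),(1,27),(2,53),(3,50)],
    [(0,0),(0,7),(2,2),(2,10),(2,19)]]),
   (55, [
    [(0,0),(0,9),(1,40),(2,45),(3,22)], [(0,0),(0,10),(1,14),(1,15),(3,45)],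
    [(0,0),(0,14),(1,39),(2,48),(3,0)], [(0,0),(0,15),(1,9),(1,38),(3,8)],
    [(0,0),(0,17),(2,18),(2,30),(2,32)], [(0,0),(0,20),(1,12),(1,36),(3,29)],
    [(0,0),(0,21),(1,34),(2,37),(3,54)]]),
   (55, [
    [(0,0),(0,23),(2,7),(2,14),(2,20)], [(0,0),(0,25),(1,26),(1,45),(3,17)],
    [(0,0),(1,2),(2,8),(3,3),(5,4)], [(0,0),(1,6),(2,33),(3,34),(4,4)],
    [(0,0),(1,7),(2,0),(3,36),(4,2)], [(0,0),(1,8),(1,17),(3,12),(3,30)],
    [(0,0),(1,10),(2,29),(3,4),(5,3)]]),
   (55, [
    [(0,0),(1,18),(1,24),(3,2),(3,14)], [(0,0),(1,19),(2,44),(3,5),(4,3)],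
    [(0,0),(1,28),(2,35),(3,20),(5,2)], [(0,0),(1,29),(2,17),(3,27),(5,0)],
    [(0,0),(1,30),(1,51),(3,38),(3,51)], [(0,0),(1,32),(1,46),(3,15),(3,43)],
    [(0,0),(1,35),(2,11),(3,37),(4,1)]]),
   (55, [
    [(0,0),(1,41),(2,21),(3,1),(5,1)], [(0,0),(1,43),(2,22),(3,53),(4,0)],
    [(0,0),(1,50),(1,54),(3,31),(3,39)], [(0,0),(2,23),(3,26),(3,32),(3,52)],
    [(0,0),(2,25),(3,19),(3,23),(3,24)], [(0,0),(2,26),(3,10),(3,40),(3,49)],
    [(0,0),(2,42),(3,6),(3,25),(3,46)]]),
   (55, [
    [(0,0),(2,49),(3,18),(3,28),(3,42)], [(1,0),(1,2),(1,15),(2,2),(2,52)],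
    [(1,0),(1,3),(1,8),(2,24),(2,44)], [(1,0),(1,7),(1,25),(2,29),(2,39)],
    [(1,0),(1,10),(1,27),(2,23),(2,38)], [(1,0),(1,12),(1,35),(2,20),(2,45)],
    [(1,0),(2,1),(2,30),(3,26),(3,43)]]),
   (55, [
    [(1,0),(2,15),(2,54),(3,5),(3,7)], [(1,0),(2,17),(2,53),(3,3),(3,35)],
    [(1,0),(2,18),(2,49),(3,6),(3,9)], [(1,0),(2,46),(2,47),(3,12),(3,19)]])]"

lemma gdd_10_23: "\<exists>(V :: nat set) \<G> \<B>. gdd 5 [(10, 23)] (V, \<G>, \<B>)"
  by (rule gdd_if_checked[where T = orbits_10_23 and Bs = base_10_23]; code_simp)

text \<open>
A group of order 400 acts on this design: the direct product of a group of order 5 and an extension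
of an elementary abelian group of order 16 by a group of order 5. There are two orbits of 16 groups
and one fixed group. The first factor fixes all groups; together with an involution it generates the
translations.
\<close>
definition orbits_10_33 :: orbits where
  "orbits_10_33 = [(32, 10, 0, 2, 2), (4, 2, 16, 4, 1), (2, 1, 16, 2, 1)]"

definition base_10_33 :: base where
  "base_10_33 = [(5, [
    [(0,0),(0,5),(8,1),(8,6),(36,0)], [(1,0),(1,5),(9,1),(9,6),(36,0)],
    [(2,0),(2,5),(12,1),(12,6),(36,0)], [(3,0),(3,5),(13,1),(13,6),(36,0)],
    [(4,0),(4,5),(10,3),(10,8),(37,0)], [(5,0),(5,5),(11,3),(11,8),(37,0)],
    [(6,0),(6,5),(14,3),(14,8),(37,0)], [(7,0),(7,5),(15,3),(15,8),(37,0)],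
    [(16,0),(16,5),(24,0),(24,5),(37,0)], [(17,0),(17,5),(25,0),(25,5),(36,0)],
    [(18,0),(18,5),(28,0),(28,5),(37,0)], [(19,0),(19,5),(29,0),(29,5),(36,0)],
    [(20,0),(20,5),(26,0),(26,5),(36,0)], [(21,0),(21,5),(27,0),(27,5),(37,0)],
    [(22,0),(22,5),(30,0),(30,5),(36,0)], [(23,0),(23,5),(31,0),(31,5),(37,0)]]),
   (10, [
    [(0,0),(0,1),(20,0),(27,4),(31,6)], [(0,0),(0,3),(2,9),(4,5),(10,7)],
    [(0,0),(1,1),(11,8),(17,4),(27,6)], [(0,0),(1,3),(5,3),(8,7),(22,1)],
    [(0,0),(1,5),(11,4),(14,7),(24,7)], [(0,0),(1,7),(5,9),(17,5),(17,8)],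
    [(0,0),(1,9),(3,2),(6,7),(26,4)], [(0,0),(2,0),(4,3),(6,3),(34,0)],
    [(0,0),(2,1),(2,4),(6,6),(14,8)], [(0,0),(2,2),(18,6),(26,7),(29,3)],
    [(0,0),(2,3),(16,6),(28,7),(29,8)], [(0,0),(2,5),(10,6),(14,1),(33,0)],
    [(0,0),(2,7),(18,3),(24,4),(25,5)], [(0,0),(2,8),(16,4),(25,1),(30,5)],
    [(0,0),(3,0),(8,3),(13,7),(27,1)], [(0,0),(3,1),(15,3),(24,3),(29,5)],
    [(0,0),(3,3),(22,9),(24,1),(26,2)], [(0,0),(3,4),(8,9),(13,9),(21,4)],
    [(0,0),(3,5),(9,7),(12,8),(25,8)], [(0,0),(3,6),(7,5),(28,1),(31,3)],
    [(0,0),(3,7),(14,5),(15,0),(22,6)], [(0,0),(3,8),(20,5),(28,2),(28,9)],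
    [(0,0),(3,9),(9,9),(12,4),(19,6)], [(0,0),(4,0),(18,5),(20,4),(31,1)]]),
   (10, [
    [(0,0),(4,1),(4,4),(6,0),(8,0)], [(0,0),(4,6),(16,2),(22,3),(29,9)],
    [(0,0),(4,7),(21,2),(22,8),(25,9)], [(0,0),(4,8),(12,6),(14,6),(35,0)],
    [(0,0),(4,9),(17,3),(18,9),(27,0)], [(0,0),(5,0),(7,2),(12,0),(20,7)],
    [(0,0),(5,1),(6,9),(7,8),(28,5)], [(0,0),(5,2),(12,9),(15,9),(25,2)],
    [(0,0),(5,4),(13,8),(23,1),(30,9)], [(0,0),(5,5),(7,4),(17,2),(21,9)],
    [(0,0),(5,6),(24,5),(30,7),(30,8)], [(0,0),(5,7),(11,3),(12,5),(16,3)],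
    [(0,0),(5,8),(12,3),(15,7),(19,9)], [(0,0),(6,1),(11,5),(13,4),(19,3)],
    [(0,0),(6,2),(19,1),(23,3),(30,2)], [(0,0),(6,4),(17,9),(21,7),(24,8)],
    [(0,0),(6,5),(11,1),(13,2),(21,0)], [(0,0),(6,8),(10,1),(12,1),(32,0)],
    [(0,0),(7,0),(15,2),(17,6),(23,8)], [(0,0),(7,1),(9,0),(14,9),(27,5)],
    [(0,0),(7,3),(16,9),(18,7),(27,2)], [(0,0),(7,6),(12,7),(15,6),(28,4)],
    [(0,0),(7,7),(26,3),(27,8),(33,1)], [(0,0),(7,9),(9,6),(14,3),(19,2)]]),
   (10, [
    [(0,0),(8,2),(10,5),(10,8),(14,4)], [(0,0),(8,4),(16,0),(28,6),(31,7)],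
    [(0,0),(8,5),(9,8),(11,0),(30,0)], [(0,0),(8,8),(18,8),(23,9),(24,2)],
    [(0,0),(9,1),(20,8),(26,0),(31,8)], [(0,0),(9,2),(9,3),(22,7),(29,4)],
    [(0,0),(9,4),(16,1),(22,5),(28,3)], [(0,0),(9,5),(18,4),(31,4),(35,1)],
    [(0,0),(10,0),(16,5),(19,4),(29,6)], [(0,0),(10,2),(23,2),(26,1),(31,0)],
    [(0,0),(10,3),(20,6),(26,5),(29,2)], [(0,0),(10,9),(16,8),(23,5),(24,9)],
    [(0,0),(11,2),(15,8),(17,0),(31,2)], [(0,0),(11,6),(12,2),(15,4),(30,3)],
    [(0,0),(11,7),(13,3),(25,7),(28,0)], [(0,0),(11,9),(22,4),(28,8),(30,1)],
    [(0,0),(13,0),(18,1),(21,1),(34,1)], [(0,0),(13,1),(17,1),(20,3),(24,6)],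
    [(0,0),(13,5),(17,7),(20,2),(37,0)], [(0,0),(13,6),(18,0),(21,5),(22,2)],
    [(0,0),(14,0),(25,0),(26,6),(29,7)], [(0,0),(14,2),(18,2),(21,3),(23,6)],
    [(0,0),(15,1),(23,4),(26,9),(30,6)], [(0,0),(15,5),(23,0),(24,0),(32,1)]]),
   (10, [
    [(0,0),(16,7),(19,7),(19,8),(29,1)], [(0,0),(19,0),(21,6),(22,0),(31,9)],
    [(0,0),(19,5),(25,3),(27,9),(30,4)], [(0,0),(20,1),(25,6),(27,7),(29,0)],
    [(0,0),(21,8),(23,7),(25,4),(26,8)], [(1,0),(1,1),(8,0),(19,8),(30,1)],
    [(1,0),(1,3),(16,0),(21,3),(31,2)], [(1,0),(2,0),(9,7),(12,3),(31,1)],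
    [(1,0),(2,1),(8,5),(13,0),(17,7)], [(1,0),(2,2),(22,7),(24,1),(24,4)],
    [(1,0),(2,3),(10,8),(11,3),(20,9)], [(1,0),(2,4),(5,9),(24,5),(27,7)],
    [(1,0),(2,5),(8,3),(13,2),(29,3)], [(1,0),(2,6),(9,5),(12,5),(23,0)],
    [(1,0),(2,7),(20,6),(28,8),(30,9)], [(1,0),(2,8),(3,7),(4,5),(30,2)],
    [(1,0),(2,9),(11,2),(25,4),(28,2)], [(1,0),(3,0),(5,3),(7,3),(34,0)],
    [(1,0),(3,1),(6,2),(19,3),(23,6)], [(1,0),(3,2),(4,6),(14,8),(16,5)],
    [(1,0),(3,4),(14,4),(17,0),(31,8)], [(1,0),(3,5),(11,6),(15,1),(33,0)],
    [(1,0),(3,6),(10,0),(19,6),(27,4)], [(1,0),(3,8),(6,4),(10,6),(18,3)]]),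
   (10, [
    [(1,0),(3,9),(4,1),(17,2),(21,5)], [(1,0),(4,0),(26,7),(28,0),(28,9)],
    [(1,0),(4,2),(15,2),(19,5),(28,3)], [(1,0),(4,3),(5,6),(10,2),(18,6)],
    [(1,0),(4,4),(13,5),(14,5),(27,8)], [(1,0),(4,7),(5,4),(21,4),(21,7)],
    [(1,0),(4,8),(13,7),(14,3),(23,9)], [(1,0),(4,9),(9,4),(14,6),(20,4)],
    [(1,0),(5,1),(16,4),(23,2),(27,6)], [(1,0),(5,5),(19,9),(20,1),(25,3)],
    [(1,0),(5,7),(6,1),(25,6),(26,4)], [(1,0),(5,8),(13,6),(15,6),(35,0)],
    [(1,0),(6,0),(9,8),(10,9),(26,6)], [(1,0),(6,3),(20,2),(22,4),(29,7)],
    [(1,0),(6,5),(8,6),(15,7),(29,2)], [(1,0),(6,6),(9,0),(17,6),(23,4)],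
    [(1,0),(6,7),(8,2),(15,5),(21,1)], [(1,0),(6,9),(28,4),(29,9),(33,1)],
    [(1,0),(7,0),(22,0),(23,7),(25,8)], [(1,0),(7,1),(20,0),(24,9),(31,3)],
    [(1,0),(7,2),(12,9),(16,3),(19,0)], [(1,0),(7,4),(10,5),(21,6),(22,9)],
    [(1,0),(7,5),(18,7),(25,0),(30,6)], [(1,0),(7,6),(16,8),(17,5),(31,6)]]),
   (10, [
    [(1,0),(7,7),(10,7),(12,0),(31,4)], [(1,0),(7,8),(11,1),(13,1),(32,0)],
    [(1,0),(7,9),(10,1),(12,8),(25,5)], [(1,0),(8,1),(20,5),(23,3),(26,3)],
    [(1,0),(8,7),(23,5),(28,5),(35,1)], [(1,0),(8,8),(18,5),(24,3),(30,7)],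
    [(1,0),(9,2),(14,0),(25,2),(31,0)], [(1,0),(9,3),(19,1),(20,8),(22,2)],
    [(1,0),(9,9),(26,1),(29,4),(30,5)], [(1,0),(10,3),(18,8),(22,5),(28,1)],
    [(1,0),(10,4),(11,5),(17,4),(27,2)], [(1,0),(11,0),(14,9),(21,8),(22,6)],
    [(1,0),(11,4),(16,6),(17,9),(23,8)], [(1,0),(11,8),(26,8),(27,1),(29,0)],
    [(1,0),(12,1),(18,1),(29,6),(30,8)], [(1,0),(12,2),(24,7),(31,7),(34,1)],
    [(1,0),(12,4),(15,0),(20,7),(27,9)], [(1,0),(12,6),(24,0),(26,2),(31,5)],
    [(1,0),(12,7),(29,8),(30,3),(37,0)], [(1,0),(13,3),(19,4),(24,6),(26,0)],
    [(1,0),(13,4),(23,1),(24,8),(28,7)], [(1,0),(13,8),(16,9),(18,0),(27,3)],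
    [(1,0),(13,9),(18,9),(22,3),(25,7)], [(1,0),(14,1),(16,1),(18,4),(25,9)]]),
   (10, [
    [(1,0),(14,7),(22,1),(25,1),(32,1)], [(1,0),(15,3),(20,3),(21,2),(26,9)],
    [(1,0),(15,4),(16,2),(21,9),(27,0)], [(1,0),(15,8),(19,2),(29,1),(30,4)],
    [(1,0),(15,9),(18,2),(28,6),(29,5)], [(2,0),(2,1),(22,0),(27,6),(31,4)],
    [(2,0),(3,1),(15,8),(19,4),(31,6)], [(2,0),(3,3),(7,3),(12,7),(20,1)],
    [(2,0),(3,5),(10,7),(15,4),(28,7)], [(2,0),(3,7),(7,9),(19,5),(19,8)],
    [(2,0),(4,0),(6,1),(6,4),(12,0)], [(2,0),(4,1),(9,4),(15,5),(17,3)],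
    [(2,0),(4,2),(17,1),(21,3),(26,2)], [(2,0),(4,4),(19,9),(23,7),(28,8)],
    [(2,0),(4,5),(9,2),(15,1),(23,0)], [(2,0),(4,8),(8,1),(14,1),(32,0)],
    [(2,0),(4,9),(5,8),(7,1),(24,5)], [(2,0),(5,0),(11,2),(19,6),(21,8)],
    [(2,0),(5,1),(10,9),(13,0),(31,5)], [(2,0),(5,2),(7,0),(8,0),(22,7)],
    [(2,0),(5,3),(16,7),(18,9),(31,2)], [(2,0),(5,4),(7,5),(19,2),(23,9)],
    [(2,0),(5,6),(8,7),(11,6),(24,4)], [(2,0),(5,7),(30,3),(31,8),(33,0)]]),
   (10, [
    [(2,0),(5,9),(10,3),(13,6),(17,2)], [(2,0),(6,0),(16,5),(22,4),(27,1)],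
    [(2,0),(6,6),(18,2),(20,3),(25,9)], [(2,0),(6,7),(20,8),(23,2),(29,9)],
    [(2,0),(6,8),(8,6),(10,6),(35,1)], [(2,0),(6,9),(16,9),(19,3),(31,0)],
    [(2,0),(7,2),(8,9),(11,9),(29,2)], [(2,0),(7,4),(9,8),(21,1),(26,9)],
    [(2,0),(7,6),(26,7),(26,8),(28,5)], [(2,0),(7,7),(8,5),(15,3),(18,3)],
    [(2,0),(7,8),(8,3),(11,7),(17,9)], [(2,0),(8,2),(11,4),(15,6),(26,3)],
    [(2,0),(9,0),(16,1),(23,1),(34,1)], [(2,0),(9,1),(19,1),(22,3),(28,6)],
    [(2,0),(9,3),(15,7),(24,0),(29,7)], [(2,0),(9,5),(19,7),(22,2),(37,0)],
    [(2,0),(9,6),(16,0),(20,2),(23,5)], [(2,0),(10,0),(25,7),(29,0),(30,6)],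
    [(2,0),(10,2),(16,2),(21,6),(23,3)], [(2,0),(10,4),(12,2),(14,5),(14,8)],
    [(2,0),(11,1),(21,4),(26,6),(30,9)], [(2,0),(11,5),(21,0),(28,0),(32,1)],
    [(2,0),(11,8),(15,2),(19,0),(27,2)], [(2,0),(12,4),(18,0),(24,6),(27,7)]]),
   (10, [
    [(2,0),(12,5),(13,8),(15,0),(26,0)], [(2,0),(12,8),(16,8),(21,9),(28,2)],
    [(2,0),(13,1),(22,8),(27,8),(30,0)], [(2,0),(13,2),(13,3),(20,7),(25,4)],
    [(2,0),(13,4),(18,1),(20,5),(24,3)], [(2,0),(13,5),(16,4),(27,4),(35,0)],
    [(2,0),(14,0),(17,4),(18,5),(25,6)], [(2,0),(14,2),(21,2),(27,0),(30,1)],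
    [(2,0),(14,3),(22,6),(25,2),(30,5)], [(2,0),(14,9),(18,8),(21,5),(28,9)],
    [(2,0),(15,9),(20,4),(24,8),(26,1)], [(2,0),(17,0),(20,0),(23,6),(27,9)],
    [(2,0),(17,5),(26,4),(29,3),(31,9)], [(2,0),(17,7),(17,8),(18,7),(25,1)],
    [(2,0),(21,7),(23,8),(29,4),(30,8)], [(2,0),(22,1),(25,0),(29,6),(31,7)],
    [(3,0),(3,1),(12,0),(17,8),(26,1)], [(3,0),(3,3),(18,0),(23,3),(27,2)],
    [(3,0),(4,0),(13,8),(14,9),(30,6)], [(3,0),(4,1),(7,7),(29,6),(30,4)],
    [(3,0),(4,3),(20,4),(22,2),(25,7)], [(3,0),(4,5),(11,7),(12,6),(25,2)],
    [(3,0),(4,6),(13,0),(19,6),(21,4)], [(3,0),(4,7),(11,5),(12,2),(23,1)]]),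
   (10, [
    [(3,0),(4,9),(24,4),(25,9),(33,0)], [(3,0),(5,0),(20,0),(21,7),(29,8)],
    [(3,0),(5,1),(22,0),(27,3),(28,9)], [(3,0),(5,2),(8,9),(17,0),(18,3)],
    [(3,0),(5,4),(14,5),(20,9),(23,6)], [(3,0),(5,5),(16,7),(26,6),(29,0)],
    [(3,0),(5,6),(18,8),(19,5),(27,6)], [(3,0),(5,7),(8,0),(14,7),(27,4)],
    [(3,0),(5,8),(9,1),(15,1),(32,0)], [(3,0),(5,9),(8,8),(14,1),(29,5)],
    [(3,0),(6,0),(24,0),(24,9),(30,7)], [(3,0),(6,2),(11,2),(17,5),(24,3)],
    [(3,0),(6,3),(7,6),(14,2),(16,6)], [(3,0),(6,4),(9,5),(10,5),(31,8)],
    [(3,0),(6,7),(7,4),(23,4),(23,7)], [(3,0),(6,8),(9,7),(10,3),(21,9)],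
    [(3,0),(6,9),(10,6),(13,4),(22,4)], [(3,0),(7,1),(18,4),(21,2),(31,6)],
    [(3,0),(7,5),(17,9),(22,1),(29,3)], [(3,0),(7,8),(9,6),(11,6),(35,1)],
    [(3,0),(8,1),(16,1),(25,6),(26,8)], [(3,0),(8,2),(27,7),(28,7),(34,1)],
    [(3,0),(8,4),(11,0),(22,7),(31,9)], [(3,0),(8,6),(27,5),(28,0),(30,2)]]),
   (10, [
    [(3,0),(8,7),(25,8),(26,3),(37,0)], [(3,0),(9,3),(17,4),(28,6),(30,0)],
    [(3,0),(9,4),(21,1),(24,7),(28,8)], [(3,0),(9,8),(16,0),(18,9),(31,3)],
    [(3,0),(9,9),(16,9),(20,3),(29,7)], [(3,0),(10,0),(13,2),(27,0),(29,2)],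
    [(3,0),(10,1),(16,4),(18,1),(29,9)], [(3,0),(10,7),(20,1),(29,1),(32,1)],
    [(3,0),(10,9),(15,0),(20,6),(23,8)], [(3,0),(11,3),(22,3),(23,2),(30,9)],
    [(3,0),(11,4),(18,2),(23,9),(31,0)], [(3,0),(11,8),(17,2),(25,1),(26,4)],
    [(3,0),(11,9),(16,2),(24,6),(25,5)], [(3,0),(12,1),(21,3),(22,5),(30,3)],
    [(3,0),(12,7),(21,5),(24,5),(35,0)], [(3,0),(12,8),(16,5),(26,7),(28,3)],
    [(3,0),(13,3),(17,1),(20,2),(22,8)], [(3,0),(13,9),(25,4),(26,5),(30,1)],
    [(3,0),(14,3),(16,8),(20,5),(24,1)], [(3,0),(14,4),(15,5),(19,4),(31,2)],
    [(3,0),(15,4),(18,6),(19,9),(21,8)], [(3,0),(15,8),(25,0),(30,8),(31,1)],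
    [(4,0),(4,1),(16,2),(25,6),(29,8)], [(4,0),(5,1),(9,0),(21,6),(25,8)]]),
   (10, [
    [(4,0),(5,5),(9,6),(12,9),(26,9)], [(4,0),(6,2),(22,8),(24,9),(31,5)],
    [(4,0),(6,3),(20,8),(30,9),(31,0)], [(4,0),(6,5),(8,8),(12,3),(33,0)],
    [(4,0),(6,7),(22,5),(26,6),(27,7)], [(4,0),(6,8),(20,6),(27,3),(28,7)],
    [(4,0),(7,0),(10,5),(15,9),(25,3)], [(4,0),(7,1),(13,5),(26,5),(31,7)],
    [(4,0),(7,3),(18,1),(24,4),(26,3)], [(4,0),(7,4),(10,1),(15,1),(17,6)],
    [(4,0),(7,5),(11,9),(14,0),(27,0)], [(4,0),(7,7),(12,7),(13,2),(18,8)],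
    [(4,0),(7,8),(16,7),(30,1),(30,4)], [(4,0),(7,9),(11,1),(14,6),(23,8)],
    [(4,0),(8,0),(8,7),(10,4),(12,6)], [(4,0),(8,1),(19,7),(20,0),(26,1)],
    [(4,0),(8,2),(20,7),(23,6),(31,8)], [(4,0),(8,4),(19,4),(24,3),(29,2)],
    [(4,0),(8,5),(16,8),(24,7),(31,4)], [(4,0),(9,1),(18,6),(28,3),(30,0)],
    [(4,0),(9,2),(10,7),(11,0),(28,2)], [(4,0),(9,4),(13,0),(21,2),(29,4)],
    [(4,0),(9,8),(13,6),(14,4),(28,5)], [(4,0),(9,9),(15,5),(27,9),(30,2)]]),
   (10, [
    [(4,0),(10,0),(19,1),(22,0),(26,4)], [(4,0),(10,6),(20,2),(29,9),(30,8)],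
    [(4,0),(11,3),(16,0),(24,2),(29,0)], [(4,0),(11,4),(11,5),(18,9),(31,6)],
    [(4,0),(11,6),(18,7),(20,3),(30,5)], [(4,0),(11,7),(22,6),(29,6),(35,1)],
    [(4,0),(12,2),(24,8),(27,2),(31,9)], [(4,0),(12,4),(17,5),(19,8),(22,4)],
    [(4,0),(13,3),(19,6),(24,1),(28,8)], [(4,0),(13,7),(19,2),(26,2),(32,1)],
    [(4,0),(15,2),(17,3),(22,3),(34,0)], [(4,0),(15,3),(16,5),(21,3),(26,8)],
    [(4,0),(15,7),(16,4),(21,9),(36,0)], [(4,0),(15,8),(17,7),(18,4),(22,2)],
    [(4,0),(16,3),(25,9),(27,8),(31,2)], [(4,0),(17,0),(19,9),(24,0),(27,6)],
    [(4,0),(17,8),(18,2),(23,2),(29,1)], [(4,0),(20,9),(23,0),(23,9),(31,3)],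
    [(4,0),(23,7),(25,1),(27,5),(28,6)], [(5,0),(5,1),(10,2),(23,0),(28,3)],
    [(5,0),(5,3),(17,5),(20,2),(29,4)], [(5,0),(6,0),(11,9),(14,5),(29,3)],
    [(5,0),(6,1),(10,7),(15,2),(21,9)], [(5,0),(6,2),(18,9),(26,3),(26,6)]]),
   (10, [
    [(5,0),(6,3),(8,0),(9,5),(16,1)], [(5,0),(6,5),(10,5),(15,4),(31,5)],
    [(5,0),(6,6),(11,7),(14,7),(19,2)], [(5,0),(6,7),(16,8),(28,1),(30,0)],
    [(5,0),(6,9),(9,4),(27,6),(30,4)], [(5,0),(7,4),(12,6),(21,2),(29,0)],
    [(5,0),(7,5),(9,8),(13,3),(33,0)], [(5,0),(7,6),(8,2),(23,8),(25,6)],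
    [(5,0),(8,5),(18,7),(22,0),(30,3)], [(5,0),(8,6),(9,7),(21,6),(25,4)],
    [(5,0),(9,0),(24,0),(25,3),(31,2)], [(5,0),(9,2),(12,1),(17,0),(18,8)],
    [(5,0),(9,6),(19,0),(20,8),(21,1)], [(5,0),(10,0),(22,7),(26,5),(28,9)],
    [(5,0),(10,3),(16,7),(19,5),(24,5)], [(5,0),(10,9),(19,7),(30,7),(35,1)],
    [(5,0),(11,1),(24,3),(28,7),(31,6)], [(5,0),(11,4),(12,2),(27,4),(29,2)],
    [(5,0),(11,5),(16,0),(18,4),(23,3)], [(5,0),(12,3),(20,3),(22,6),(27,1)],
    [(5,0),(12,9),(18,3),(27,3),(32,1)], [(5,0),(13,0),(23,4),(28,6),(31,3)],
    [(5,0),(13,1),(22,4),(30,8),(31,7)], [(5,0),(13,2),(14,6),(16,9),(25,1)]]),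
   (10, [
    [(5,0),(13,5),(16,5),(17,4),(24,1)], [(5,0),(13,6),(17,1),(20,4),(25,2)],
    [(5,0),(14,3),(22,3),(28,0),(31,8)], [(5,0),(14,4),(26,9),(29,9),(34,0)],
    [(5,0),(14,8),(24,4),(26,2),(29,7)], [(5,0),(14,9),(28,5),(31,0),(36,0)],
    [(5,0),(15,0),(20,1),(22,2),(25,5)], [(5,0),(15,1),(18,5),(22,1),(27,9)],
    [(5,0),(15,5),(23,6),(24,2),(26,8)], [(5,0),(15,6),(19,3),(26,0),(30,9)],
    [(6,0),(6,1),(18,2),(25,8),(29,6)], [(6,0),(7,1),(13,0),(23,6),(29,8)],
    [(6,0),(7,5),(8,9),(13,6),(30,9)], [(6,0),(8,2),(27,9),(28,8),(31,2)],
    [(6,0),(8,4),(17,8),(19,5),(20,4)], [(6,0),(8,6),(12,0),(12,7),(14,4)],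
    [(6,0),(9,0),(13,4),(23,2),(25,4)], [(6,0),(9,3),(17,6),(24,8),(28,1)],
    [(6,0),(9,6),(10,4),(13,8),(24,5)], [(6,0),(9,7),(17,2),(30,2),(32,1)],
    [(6,0),(11,2),(19,3),(20,3),(34,0)], [(6,0),(11,3),(18,5),(23,3),(30,8)],
    [(6,0),(11,5),(13,9),(26,2),(31,9)], [(6,0),(11,7),(18,4),(23,9),(36,0)]]),
   (10, [
    [(6,0),(11,8),(16,4),(19,7),(20,2)], [(6,0),(12,1),(17,7),(22,0),(30,1)],
    [(6,0),(12,2),(21,6),(22,7),(27,8)], [(6,0),(12,4),(17,4),(25,2),(28,3)],
    [(6,0),(12,5),(18,8),(27,4),(28,7)], [(6,0),(13,1),(16,6),(24,3),(26,0)],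
    [(6,0),(13,2),(14,7),(15,0),(24,2)], [(6,0),(14,0),(17,1),(20,0),(30,4)],
    [(6,0),(14,6),(22,2),(25,9),(26,8)], [(6,0),(15,3),(18,0),(25,0),(28,2)],
    [(6,0),(15,4),(15,5),(16,9),(27,6)], [(6,0),(15,6),(16,7),(22,3),(26,5)],
    [(6,0),(15,7),(20,6),(25,6),(35,0)], [(6,0),(16,2),(19,8),(21,2),(25,1)],
    [(6,0),(17,9),(19,0),(28,0),(31,6)], [(6,0),(18,3),(27,2),(29,9),(31,8)],
    [(6,0),(21,0),(21,9),(22,9),(27,3)], [(6,0),(21,7),(24,6),(29,1),(31,5)],
    [(7,0),(7,1),(14,2),(21,0),(24,3)], [(7,0),(7,3),(19,5),(22,2),(25,4)],
    [(7,0),(8,1),(13,2),(16,8),(19,0)], [(7,0),(8,2),(15,4),(25,2),(31,4)],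
    [(7,0),(8,3),(20,6),(22,3),(31,1)], [(7,0),(8,9),(16,3),(31,3),(32,1)]]),
   (10, [
    [(7,0),(9,0),(21,4),(24,6),(27,3)], [(7,0),(9,1),(20,4),(26,8),(27,7)],
    [(7,0),(9,2),(10,6),(18,9),(29,1)], [(7,0),(9,5),(18,5),(19,4),(28,1)],
    [(7,0),(9,6),(19,1),(22,4),(29,2)], [(7,0),(10,3),(20,3),(24,0),(27,8)],
    [(7,0),(10,4),(25,9),(30,9),(34,0)], [(7,0),(10,8),(25,7),(28,4),(30,2)],
    [(7,0),(10,9),(24,5),(27,0),(36,0)], [(7,0),(11,0),(20,2),(22,1),(29,5)],
    [(7,0),(11,1),(16,5),(20,1),(31,9)], [(7,0),(11,5),(21,6),(28,2),(30,8)],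
    [(7,0),(11,6),(17,3),(26,9),(30,0)], [(7,0),(12,5),(16,7),(20,0),(26,3)],
    [(7,0),(12,6),(13,7),(23,6),(29,4)], [(7,0),(13,0),(27,2),(28,0),(29,3)],
    [(7,0),(13,6),(17,0),(22,8),(23,1)], [(7,0),(14,0),(20,7),(24,9),(30,5)],
    [(7,0),(14,3),(17,5),(18,7),(28,5)], [(7,0),(14,9),(17,7),(26,7),(35,0)],
    [(7,0),(15,1),(24,7),(27,6),(28,3)], [(7,0),(15,5),(16,4),(18,0),(21,3)],
    [(8,0),(8,1),(21,8),(23,0),(26,4)], [(8,0),(9,7),(11,1),(25,2),(25,9)]]),
   (10, [
    [(8,0),(9,9),(13,2),(14,9),(20,8)], [(8,0),(10,1),(21,4),(25,7),(28,3)],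
    [(8,0),(10,2),(23,5),(26,8),(28,9)], [(8,0),(10,5),(12,0),(14,5),(34,0)],
    [(8,0),(10,8),(19,3),(24,6),(30,7)], [(8,0),(10,9),(17,3),(27,6),(30,2)],
    [(8,0),(11,3),(14,1),(15,0),(18,9)], [(8,0),(11,7),(15,6),(25,6),(27,3)],
    [(8,0),(11,8),(16,9),(22,1),(22,2)], [(8,0),(12,2),(19,7),(20,1),(28,0)],
    [(8,0),(12,3),(18,1),(19,2),(24,0)], [(8,0),(12,7),(16,8),(17,9),(28,7)],
    [(8,0),(12,8),(17,5),(22,9),(24,8)], [(8,0),(13,3),(16,5),(20,6),(30,3)],
    [(8,0),(13,6),(15,7),(18,5),(23,7)], [(8,0),(13,8),(18,3),(18,6),(26,9)],
    [(8,0),(14,4),(22,6),(29,5),(31,7)], [(8,0),(14,6),(16,2),(25,3),(27,1)],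
    [(8,0),(15,5),(21,6),(24,3),(28,1)], [(8,0),(15,9),(20,7),(21,2),(33,1)],
    [(8,0),(17,0),(19,4),(21,1),(26,5)], [(8,0),(17,7),(21,3),(22,8),(29,9)],
    [(8,0),(17,8),(20,2),(27,2),(31,1)], [(8,0),(19,5),(24,1),(29,1),(29,2)]]),
   (10, [
    [(8,0),(23,3),(27,0),(29,4),(30,4)], [(9,0),(9,3),(23,6),(24,4),(27,7)],
    [(9,0),(10,2),(18,3),(18,4),(20,1)], [(9,0),(10,3),(13,9),(25,6),(27,9)],
    [(9,0),(10,7),(12,8),(13,7),(22,6)], [(9,0),(10,9),(11,6),(27,1),(27,8)],
    [(9,0),(11,1),(12,4),(16,9),(21,1)], [(9,0),(11,3),(21,0),(24,8),(31,6)],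
    [(9,0),(11,5),(13,0),(15,5),(34,0)], [(9,0),(11,7),(17,7),(26,5),(29,3)],
    [(9,0),(11,9),(14,3),(17,0),(20,8)], [(9,0),(12,2),(16,5),(16,8),(30,1)],
    [(9,0),(12,7),(18,2),(22,3),(26,0)], [(9,0),(13,1),(14,4),(29,7),(31,0)],
    [(9,0),(14,1),(18,8),(19,3),(33,1)], [(9,0),(14,5),(19,1),(26,6),(30,8)],
    [(9,0),(15,2),(17,2),(30,4),(31,1)], [(9,0),(15,3),(16,3),(23,7),(26,4)],
    [(9,0),(15,7),(17,4),(22,0),(28,1)], [(9,0),(15,8),(23,0),(24,2),(25,9)],
    [(10,0),(10,1),(17,8),(19,0),(24,4)], [(10,0),(11,9),(12,9),(15,2),(16,8)],
    [(10,0),(12,4),(18,6),(29,7),(31,5)], [(10,0),(12,6),(20,2),(25,1),(27,3)]]),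
   (10, [
    [(10,0),(13,5),(17,6),(26,3),(30,1)], [(10,0),(13,7),(15,6),(19,7),(22,5)],
    [(10,0),(13,9),(16,7),(17,2),(33,1)], [(10,0),(14,2),(16,1),(23,7),(30,0)],
    [(10,0),(14,3),(22,1),(23,2),(26,0)], [(10,0),(14,7),(20,8),(21,9),(30,7)],
    [(10,0),(14,8),(18,9),(21,5),(26,8)], [(10,0),(15,3),(16,6),(20,5),(28,3)],
    [(10,0),(15,8),(22,3),(22,6),(24,9)], [(10,0),(16,2),(21,8),(25,2),(29,1)],
    [(10,0),(17,1),(21,0),(23,4),(24,5)], [(10,0),(17,3),(18,8),(21,7),(31,9)],
    [(10,0),(19,3),(25,0),(28,4),(31,4)], [(10,0),(23,5),(26,1),(31,1),(31,2)],
    [(11,0),(11,3),(19,6),(25,7),(26,4)], [(11,0),(12,1),(22,8),(23,3),(33,1)],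
    [(11,0),(12,4),(15,1),(29,0),(31,7)], [(11,0),(12,5),(23,1),(24,6),(28,8)],
    [(11,0),(13,2),(21,2),(28,4),(29,1)], [(11,0),(13,3),(19,7),(20,3),(24,4)],
    [(11,0),(13,7),(18,0),(21,4),(30,1)], [(11,0),(13,8),(19,0),(26,2),(27,9)],
    [(11,0),(14,2),(20,5),(20,8),(28,1)], [(11,0),(14,7),(18,3),(22,2),(24,0)]]),
   (10, [
    [(12,0),(12,1),(21,0),(23,8),(30,4)], [(12,0),(13,7),(15,1),(29,2),(29,9)],
    [(12,0),(14,1),(23,4),(24,3),(29,7)], [(12,0),(14,2),(21,5),(24,9),(30,8)],
    [(12,0),(14,8),(17,3),(26,7),(28,6)], [(12,0),(14,9),(19,3),(26,2),(31,6)],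
    [(12,0),(15,8),(18,9),(20,1),(20,2)], [(12,0),(17,4),(19,0),(23,1),(30,5)],
    [(12,0),(17,5),(25,1),(25,2),(28,1)], [(12,0),(19,7),(20,8),(23,3),(25,9)],
    [(12,0),(19,8),(22,2),(27,1),(31,2)], [(12,0),(21,3),(25,4),(26,4),(31,0)],
    [(13,0),(13,3),(21,6),(28,4),(31,7)], [(13,0),(14,2),(16,3),(16,4),(22,1)],
    [(13,0),(14,9),(15,6),(31,1),(31,8)], [(13,0),(15,3),(23,0),(27,6),(28,8)],
    [(13,0),(15,7),(19,7),(25,3),(30,5)], [(14,0),(14,1),(17,0),(19,8),(28,4)],
    [(14,0),(16,8),(19,3),(23,7),(27,9)], [(14,0),(17,3),(24,4),(27,4),(29,0)],
    [(14,0),(18,2),(23,8),(25,1),(29,2)], [(14,0),(19,1),(21,4),(23,0),(28,5)],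
    [(14,0),(21,5),(27,1),(27,2),(30,1)], [(15,0),(15,3),(17,6),(29,7),(30,4)]]),
   (10, [
    [(16,0),(18,0),(20,5),(22,5),(34,1)], [(16,0),(18,5),(26,0),(30,5),(33,1)],
    [(16,0),(20,0),(28,0),(30,0),(35,1)], [(16,0),(22,0),(26,5),(28,5),(32,1)],
    [(17,0),(19,0),(21,5),(23,5),(34,0)], [(17,0),(19,5),(27,0),(31,5),(33,0)],
    [(17,0),(21,0),(29,0),(31,0),(35,0)], [(17,0),(23,0),(27,5),(29,5),(32,0)],
    [(18,0),(20,0),(24,5),(30,5),(32,1)], [(18,0),(22,0),(24,0),(26,0),(35,0)],
    [(19,0),(21,0),(25,5),(31,5),(32,0)], [(19,0),(23,0),(25,0),(27,0),(35,1)],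
    [(20,0),(22,5),(24,0),(28,5),(33,1)], [(21,0),(23,5),(25,0),(29,5),(33,0)],
    [(24,0),(26,5),(28,0),(30,5),(34,1)], [(25,0),(27,5),(29,0),(31,5),(34,0)]])]"

lemma gdd_10_33: "\<exists>(V :: nat set) \<G> \<B>. gdd 5 [(10, 33)] (V, \<G>, \<B>)"
  by (rule gdd_if_checked[where T = orbits_10_33 and Bs = base_10_33]; code_simp)

theorem theorem2p1:
  "\<forall>(g, u) \<in> {(2, 35), (2, 71), (2, 111), (3, 45), (6, 15), (10, 15), (10, 23), (10, 33)}.
     \<exists>(V :: nat set) \<G> \<B>. gdd 5 [(g, u)] (V, \<G>, \<B>)"
  using gdd_2_35 gdd_2_71 gdd_2_111 gdd_3_45
    gdd_6_15 gdd_10_15 gdd_10_23 gdd_10_33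
  by simp

end
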